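(* Let $(X,\mu)$ be a standard probability space and let $\mathbb G\leq\mathrm{Aut}(X,\mu)$ be an ergodic full group. (1) Any Polish group topology on $\mathbb G$ is weaker than the uniform topology. (2) Any Polish group topology on $\mathbb G$ refines the weak topology. (3) The group $\mathbb G$ carries at most one Polish group topology.
   Context: A standard probability space is a standard Borel space equipped with a non-atomic Borel probability measure. $\mathrm{Aut}(X,\mu)$ is the group of measure-preserving Borel bijections of $(X,\mu)$, identified when equal almost everywhere. The weak topology on it is the one for which $T_n\to T$ iff $\mu(T_n(A)\triangle T(A))\to0$ for all measurable $A$; the uniform topology is induced by the metric $d_u(T,S)=\mu(\{x:Tx\neq Sx\})$. A subgroup $\mathbb G\leq\mathrm{Aut}(X,\mu)$ is a full group if it is stable under cutting and pasting: whenever $(T_n)_{n\in\mathbb N}$ is a sequence in $\mathbb G$, $(A_n)_{n\in\mathbb N}$ is a measurable partition of $X$ and $T\in\mathrm{Aut}(X,\mu)$ satisfies $T_{\restriction A_n}=T_{n\restriction A_n}$ for all $n$, then $T\in\mathbb G$. It is ergodic if the only measurable sets $A$ with $\mu(A\triangle gA)=0$ for all $g\in\mathbb G$ are those of measure $0$ or $1$. A Polish group topology on a group is a Polish topology making it a topological group. *)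

theory Defs
  imports "HOL-Probability.Probability" "HOL-Algebra.Group"
begin

section \<open>Polish topologies and standard probability spaces\<close>

definition polish_topology :: "'a topology \<Rightarrow> bool" where
  "polish_topology X \<longleftrightarrow> separable_space X \<and> completely_metrizable_space X"

definition standard_borel_space :: "'a measure \<Rightarrow> bool" where
  "standard_borel_space M \<longleftrightarrow>
     (\<exists>X. polish_topology X \<and> topspace X = space M \<and>
          sets M = sigma_sets (space M) {U. openin X U})"

definition nonatomic :: "'a measure \<Rightarrow> bool" where
  "nonatomic M \<longleftrightarrow>
     (\<forall>A\<in>sets M. 0 < measure M A \<longrightarrow>
        (\<exists>B\<in>sets M. B \<subseteq> A \<and> 0 < measure M B \<and> measure M B < measure M A))"

definition standard_prob_space :: "'a measure \<Rightarrow> bool" where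
  "standard_prob_space M \<longleftrightarrow> prob_space M \<and> standard_borel_space M \<and> nonatomic M"

section \<open>The automorphism group\<close>

text \<open>Only the values on \<open>space M\<close> matter: the identification almost everywhere below
  also identifies functions that differ outside \<open>space M\<close>.
  On a standard Borel space measurability of the inverse is automatic (Lusin--Souslin).\<close>

definition mp_bij :: "'a measure \<Rightarrow> ('a \<Rightarrow> 'a) set" where
  "mp_bij M = {T. bij_betw T (space M) (space M) \<and> T \<in> measurable M M \<and>
                  inv_into (space M) T \<in> measurable M M \<and> distr M M T = M}"

definition aut_class :: "'a measure \<Rightarrow> ('a \<Rightarrow> 'a) \<Rightarrow> ('a \<Rightarrow> 'a) set" where
  "aut_class M T = {S \<in> mp_bij M. AE x in M. S x = T x}"

text \<open>A chosen representative of a class. The lemmas below show that the notions defined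
  through it do not depend on the choice.\<close>

definition rep :: "('a \<Rightarrow> 'a) set \<Rightarrow> 'a \<Rightarrow> 'a" where
  "rep g = (SOME T. T \<in> g)"

definition Aut :: "'a measure \<Rightarrow> ('a \<Rightarrow> 'a) set monoid" where
  "Aut M = \<lparr>carrier = aut_class M ` mp_bij M,
            mult = (\<lambda>g h. aut_class M (rep g \<circ> rep h)),
            one = aut_class M id\<rparr>"

definition uniform_dist :: "'a measure \<Rightarrow> ('a \<Rightarrow> 'a) set \<Rightarrow> ('a \<Rightarrow> 'a) set \<Rightarrow> real" where
  "uniform_dist M g h = measure M {x \<in> space M. rep g x \<noteq> rep h x}"

definition uniform_topology :: "'a measure \<Rightarrow> ('a \<Rightarrow> 'a) set topology" where
  "uniform_topology M = Metric_space.mtopology (carrier (Aut M)) (uniform_dist M)"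

text \<open>The characterisation by convergent sequences is lemma \<open>limitin_weak_topology\<close>.\<close>

definition weak_topology :: "'a measure \<Rightarrow> ('a \<Rightarrow> 'a) set topology" where
  "weak_topology M = topology_generated_by
     {{h \<in> carrier (Aut M). measure M (sym_diff (rep h ` A) (rep g ` A)) < e} |g A e.
        g \<in> carrier (Aut M) \<and> A \<in> sets M \<and> 0 < e}"

section \<open>Full groups and ergodicity\<close>

text \<open>The pieces of the partition may be empty.\<close>

definition full_group :: "'a measure \<Rightarrow> ('a \<Rightarrow> 'a) set set \<Rightarrow> bool" where
  "full_group M G \<longleftrightarrow> subgroup G (Aut M) \<and>
     (\<forall>(T :: nat \<Rightarrow> ('a \<Rightarrow> 'a) set) (A :: nat \<Rightarrow> 'a set). \<forall>S\<in>carrier (Aut M).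
        (\<forall>n. T n \<in> G) \<longrightarrow> (\<forall>n. A n \<in> sets M) \<longrightarrow> disjoint_family A \<longrightarrow>
        (\<Union>n. A n) = space M \<longrightarrow>
        (\<forall>n. AE x in M. x \<in> A n \<longrightarrow> rep S x = rep (T n) x) \<longrightarrow> S \<in> G)"

definition ergodic_group :: "'a measure \<Rightarrow> ('a \<Rightarrow> 'a) set set \<Rightarrow> bool" where
  "ergodic_group M G \<longleftrightarrow>
     (\<forall>A\<in>sets M. (\<forall>g\<in>G. measure M (sym_diff A (rep g ` A)) = 0) \<longrightarrow>
        measure M A = 0 \<or> measure M A = 1)"

section \<open>Polish group topologies\<close>

definition group_topology :: "('g, 'm) monoid_scheme \<Rightarrow> 'g topology \<Rightarrow> bool" where
  "group_topology H \<tau> \<longleftrightarrow> topspace \<tau> = carrier H \<and>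
     continuous_map (prod_topology \<tau> \<tau>) \<tau> (\<lambda>(x, y). x \<otimes>\<^bsub>H\<^esub> y) \<and>
     continuous_map \<tau> \<tau> (\<lambda>x. inv\<^bsub>H\<^esub> x)"

definition polish_group_topology :: "('g, 'm) monoid_scheme \<Rightarrow> 'g topology \<Rightarrow> bool" where
  "polish_group_topology H \<tau> \<longleftrightarrow> polish_topology \<tau> \<and> group_topology H \<tau>"

section \<open>Well-definedness\<close>

lemma mp_bijD:
  assumes "T \<in> mp_bij M"
  shows "bij_betw T (space M) (space M)" "T \<in> measurable M M"
    "inv_into (space M) T \<in> measurable M M" "distr M M T = M"
  using assms by (auto simp: mp_bij_def)

lemma id_mp_bij: "id \<in> mp_bij M"
proof -
  have "inv_into (space M) id \<in> measurable M M \<longleftrightarrow> id \<in> measurable M M"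
    by (intro measurable_cong) (metis f_inv_into_f id_apply image_id)
  then show ?thesis
    by (auto simp: mp_bij_def id_def distr_id bij_betw_def inj_on_def)
qed

lemma comp_mp_bij:
  assumes S: "S \<in> mp_bij M" and T: "T \<in> mp_bij M"
  shows "S \<circ> T \<in> mp_bij M"
proof -
  note s = mp_bijD[OF S] and t = mp_bijD[OF T]
  have b: "bij_betw (S \<circ> T) (space M) (space M)"
    using s(1) t(1) bij_betw_trans by blast
  have "inv_into (space M) (S \<circ> T) x = (inv_into (space M) T \<circ> inv_into (space M) S) x"
    if "x \<in> space M" for x
    using inv_into_comp[of S T "space M" x] s(1) t(1) that
    by (auto simp: bij_betw_def)
  then have "inv_into (space M) (S \<circ> T) \<in> measurable M M \<longleftrightarrow>
      inv_into (space M) T \<circ> inv_into (space M) S \<in> measurable M M"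
    by (rule measurable_cong)
  then have i: "inv_into (space M) (S \<circ> T) \<in> measurable M M"
    using measurable_comp[OF s(3) t(3)] by simp
  have "distr M M (S \<circ> T) = M"
    using distr_distr[OF s(2) t(2)] s(4) t(4) by simp
  with b i show ?thesis
    using measurable_comp[OF t(2) s(2)] by (simp add: mp_bij_def)
qed

lemma inv_mp_bij:
  assumes T: "T \<in> mp_bij M"
  shows "inv_into (space M) T \<in> mp_bij M"
proof -
  note t = mp_bijD[OF T]
  let ?I = "inv_into (space M) T"
  have b: "bij_betw ?I (space M) (space M)"
    using t(1) by (rule bij_betw_inv_into)
  have "inv_into (space M) ?I x = T x" if "x \<in> space M" for x
    using inv_into_inv_into_eq[OF t(1) that] .
  then have "inv_into (space M) ?I \<in> measurable M M \<longleftrightarrow> T \<in> measurable M M"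
    by (rule measurable_cong)
  then have i: "inv_into (space M) ?I \<in> measurable M M" using t(2) by simp
  have "distr M M ?I = distr (distr M M T) M ?I" using t(4) by simp
  also have "\<dots> = distr M M (?I \<circ> T)" by (rule distr_distr[OF t(3) t(2)])
  also have "\<dots> = distr M M (\<lambda>x. x)"
    by (rule distr_cong) (use t(1) in \<open>auto simp: bij_betw_inv_into_left\<close>)
  also have "\<dots> = M" by (simp add: distr_id)
  finally show ?thesis using b i t(3) by (simp add: mp_bij_def)
qed

lemma AE_mp_bij:
  assumes "T \<in> mp_bij M" "AE x in M. P x"
  shows "AE x in M. P (T x)"
  by (rule AE_distrD[OF mp_bijD(2)[OF assms(1)]]) (simp only: mp_bijD(4)[OF assms(1)] assms(2))

lemma image_eq_vimage:
  assumes T: "T \<in> mp_bij M" and "A \<subseteq> space M"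
  shows "T ` A = inv_into (space M) T -` A \<inter> space M"
  using mp_bijD(1)[OF T] assms(2)
  by (auto simp: bij_betw_def inv_into_f_f subset_iff image_iff) (metis f_inv_into_f)

lemma image_mp_bij:
  assumes T: "T \<in> mp_bij M" and A: "A \<in> sets M"
  shows "T ` A \<in> sets M" "measure M (T ` A) = measure M A"
proof -
  let ?I = "inv_into (space M) T"
  note i = mp_bijD[OF inv_mp_bij[OF T]]
  have e: "T ` A = ?I -` A \<inter> space M"
    using image_eq_vimage[OF T] sets.sets_into_space[OF A] by blast
  show "T ` A \<in> sets M" using e measurable_sets[OF i(2) A] by simp
  show "measure M (T ` A) = measure M A"
    using measure_distr[OF i(2) A] i(4) e by simp
qed

lemma aut_class_eq_iff:
  assumes "S \<in> mp_bij M" "T \<in> mp_bij M"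
  shows "aut_class M S = aut_class M T \<longleftrightarrow> (AE x in M. S x = T x)"
proof
  assume "aut_class M S = aut_class M T"
  moreover have "S \<in> aut_class M S" using assms by (simp add: aut_class_def)
  ultimately show "AE x in M. S x = T x" by (simp add: aut_class_def)
next
  assume st: "AE x in M. S x = T x"
  have "(AE x in M. R x = S x) \<longleftrightarrow> (AE x in M. R x = T x)" for R
  proof
    assume "AE x in M. R x = S x"
    with st show "AE x in M. R x = T x" by eventually_elim simp
  next
    assume "AE x in M. R x = T x"
    with st show "AE x in M. R x = S x" by eventually_elim simp
  qed
  then show "aut_class M S = aut_class M T" by (simp add: aut_class_def)
qed

lemma rep_in:
  assumes "g \<in> carrier (Aut M)"
  shows "rep g \<in> mp_bij M" "aut_class M (rep g) = g"
proof -
  from assms obtain T where T: "T \<in> mp_bij M" "g = aut_class M T" by (auto simp: Aut_def)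
  then have "T \<in> g" by (simp add: aut_class_def)
  then have r: "rep g \<in> g" unfolding rep_def by (rule someI[of "\<lambda>T. T \<in> g"])
  then show m: "rep g \<in> mp_bij M" using T by (simp add: aut_class_def)
  show "aut_class M (rep g) = g"
    using r T aut_class_eq_iff[OF m T(1)] by (simp add: aut_class_def)
qed

lemma rep_aut_class:
  assumes "T \<in> mp_bij M"
  shows "AE x in M. rep (aut_class M T) x = T x"
proof -
  have "aut_class M T \<in> carrier (Aut M)" using assms by (simp add: Aut_def)
  from rep_in[OF this] show ?thesis using aut_class_eq_iff[OF _ assms] by blast
qed

lemma mult_aut_class:
  assumes S: "S \<in> mp_bij M" and T: "T \<in> mp_bij M"
  shows "aut_class M S \<otimes>\<^bsub>Aut M\<^esub> aut_class M T = aut_class M (S \<circ> T)"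
proof -
  let ?s = "rep (aut_class M S)" and ?t = "rep (aut_class M T)"
  have c: "aut_class M S \<in> carrier (Aut M)" "aut_class M T \<in> carrier (Aut M)"
    using S T by (auto simp: Aut_def)
  have "AE x in M. ?s (T x) = S (T x)"
    using AE_mp_bij[OF T rep_aut_class[OF S]] .
  with rep_aut_class[OF T] have "AE x in M. (?s \<circ> ?t) x = (S \<circ> T) x" by auto
  then have "aut_class M (?s \<circ> ?t) = aut_class M (S \<circ> T)"
    using aut_class_eq_iff comp_mp_bij S T rep_in(1)[OF c(1)] rep_in(1)[OF c(2)] by blast
  then show ?thesis by (simp add: Aut_def)
qed

lemma group_Aut: "group (Aut M)"
proof (rule groupI)
  fix x y assume "x \<in> carrier (Aut M)" "y \<in> carrier (Aut M)"
  then have "rep x \<circ> rep y \<in> mp_bij M"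
    using comp_mp_bij[OF rep_in(1) rep_in(1)] by blast
  then show "x \<otimes>\<^bsub>Aut M\<^esub> y \<in> carrier (Aut M)"
    by (simp add: Aut_def)
next
  show "\<one>\<^bsub>Aut M\<^esub> \<in> carrier (Aut M)" using id_mp_bij by (auto simp: Aut_def)
next
  fix x y z assume "x \<in> carrier (Aut M)" "y \<in> carrier (Aut M)" "z \<in> carrier (Aut M)"
  then obtain R S T where "R \<in> mp_bij M" "S \<in> mp_bij M" "T \<in> mp_bij M"
    "x = aut_class M R" "y = aut_class M S" "z = aut_class M T"
    by (auto simp: Aut_def)
  then show "x \<otimes>\<^bsub>Aut M\<^esub> y \<otimes>\<^bsub>Aut M\<^esub> z = x \<otimes>\<^bsub>Aut M\<^esub> (y \<otimes>\<^bsub>Aut M\<^esub> z)"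
    by (simp add: mult_aut_class comp_mp_bij o_assoc)
next
  fix x assume "x \<in> carrier (Aut M)"
  then obtain T where T: "T \<in> mp_bij M" "x = aut_class M T" by (auto simp: Aut_def)
  have o: "\<one>\<^bsub>Aut M\<^esub> = aut_class M id" by (simp add: Aut_def)
  show "\<one>\<^bsub>Aut M\<^esub> \<otimes>\<^bsub>Aut M\<^esub> x = x"
    using T o mult_aut_class[OF id_mp_bij T(1)] by simp
  let ?I = "inv_into (space M) T"
  have "AE x in M. (?I \<circ> T) x = id x"
    using mp_bijD(1)[OF T(1)] by (intro AE_I2) (auto simp: bij_betw_inv_into_left)
  then have "aut_class M (?I \<circ> T) = aut_class M id"
    using aut_class_eq_iff comp_mp_bij inv_mp_bij T(1) id_mp_bij by blast
  then have "aut_class M ?I \<otimes>\<^bsub>Aut M\<^esub> x = \<one>\<^bsub>Aut M\<^esub>"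
    using T o mult_aut_class[OF inv_mp_bij[OF T(1)] T(1)] by simp
  moreover have "aut_class M ?I \<in> carrier (Aut M)"
    using inv_mp_bij[OF T(1)] by (simp add: Aut_def)
  ultimately show "\<exists>y\<in>carrier (Aut M). y \<otimes>\<^bsub>Aut M\<^esub> x = \<one>\<^bsub>Aut M\<^esub>" by blast
qed

lemma neq_sets:
  assumes M: "standard_borel_space M" and S: "S \<in> measurable M M" and T: "T \<in> measurable M M"
  shows "{x \<in> space M. S x \<noteq> T x} \<in> sets M"
proof -
  obtain X where X: "separable_space X" "completely_metrizable_space X"
    "topspace X = space M" "sets M = sigma_sets (space M) {U. openin X U}"
    using M by (auto simp: standard_borel_space_def polish_topology_def)
  obtain Y d where Y: "Metric_space Y d" "X = Metric_space.mtopology Y d"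
    using completely_metrizable_imp_metrizable_space[OF X(2)]
    by (auto simp: metrizable_space_def)
  interpret Metric_space Y d by fact
  have Y_eq: "Y = space M" using Y(2) X(3) by simp
  obtain D where D: "countable D" "D \<subseteq> Y" "mtopology closure_of D = Y"
    using X(1) Y(2) by (auto simp: separable_space_def)
  let ?P = "D \<times> (\<rat> :: real set)"
  let ?E = "\<lambda>(c, r). (S -` mball c r \<inter> space M) - (T -` mball c r \<inter> space M)"
  have "{x \<in> space M. S x \<noteq> T x} = (\<Union>p\<in>?P. ?E p)"
  proof (intro equalityI subsetI)
    fix x assume x: "x \<in> {x \<in> space M. S x \<noteq> T x}"
    have y: "S x \<in> Y" "T x \<in> Y" "S x \<noteq> T x"
      using x S T Y_eq by (auto dest: measurable_space)
    let ?r = "d (S x) (T x)"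
    have "0 < ?r" using y by (simp add: mdist_pos_eq)
    moreover have "S x \<in> mtopology closure_of D" using y D(3) by simp
    then have "\<forall>e>0. \<exists>c\<in>D. c \<in> mball (S x) e"
      by (simp add: metric_closure_of)
    ultimately obtain c where c: "c \<in> D" "c \<in> mball (S x) (?r / 2)"
      by (meson half_gt_zero)
    then have cs: "c \<in> Y" "d c (S x) < ?r / 2" using commute by auto
    obtain q where q: "q \<in> \<rat>" "d c (S x) < q" "q < ?r / 2"
      using Rats_dense_in_real[OF cs(2)] by blast
    have "?r \<le> d (S x) c + d c (T x)" using triangle y cs by blast
    then have "q < d c (T x)" using q cs commute[of c "S x"] by linarith
    then have "x \<in> ?E (c, q)" using x y cs q by auto
    with c(1) q(1) show "x \<in> (\<Union>p\<in>?P. ?E p)" by blast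
  qed auto
  moreover have "countable ?P" using D(1) countable_rat by (intro countable_SIGMA) auto
  moreover have "?E p \<in> sets M" for p
  proof -
    obtain c r where p: "p = (c, r)" by force
    have "mball c r \<in> sets M" using Y(2) X(4) openin_mball by (auto intro: sigma_sets.Basic)
    then show ?thesis
      using S T p by (auto intro!: sets.Diff measurable_sets)
  qed
  ultimately show ?thesis by (auto intro!: sets.countable_UN')
qed

lemma uniform_dist_aut_class:
  assumes "prob_space M" "standard_borel_space M" and S: "S \<in> mp_bij M" and T: "T \<in> mp_bij M"
  shows "uniform_dist M (aut_class M S) (aut_class M T) = measure M {x \<in> space M. S x \<noteq> T x}"
proof -
  have "rep (aut_class M S) \<in> mp_bij M" "rep (aut_class M T) \<in> mp_bij M"
    using S T by (auto intro!: rep_in(1) simp: Aut_def)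
  then have "{x \<in> space M. rep (aut_class M S) x \<noteq> rep (aut_class M T) x} \<in> sets M"
    "{x \<in> space M. S x \<noteq> T x} \<in> sets M"
    using neq_sets[OF assms(2)] S T mp_bijD(2) by blast+
  then show ?thesis
    unfolding uniform_dist_def using rep_aut_class[OF S] rep_aut_class[OF T]
    by (intro measure_eq_AE) auto
qed

lemma Metric_space_uniform_dist:
  assumes "prob_space M" and M: "standard_borel_space M"
  shows "Metric_space (carrier (Aut M)) (uniform_dist M)"
proof
  interpret prob_space M by fact
  fix g h :: "('a \<Rightarrow> 'a) set"
  show "0 \<le> uniform_dist M g h" by (simp add: uniform_dist_def)
  show "uniform_dist M g h = uniform_dist M h g" by (auto simp: uniform_dist_def eq_commute)
  assume g: "g \<in> carrier (Aut M)" and h: "h \<in> carrier (Aut M)"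
  note r = rep_in[OF g] rep_in[OF h]
  have s: "{x \<in> space M. rep g x \<noteq> rep h x} \<in> sets M"
    using neq_sets[OF M] r mp_bijD(2) by blast
  have "uniform_dist M g h = 0 \<longleftrightarrow> (AE x in M. rep g x = rep h x)"
    unfolding uniform_dist_def by (subst AE_iff_measurable[OF s]) (auto simp: emeasure_eq_measure)
  then show "uniform_dist M g h = 0 \<longleftrightarrow> g = h"
    using aut_class_eq_iff[OF r(1) r(3)] r by simp
  fix k assume k: "k \<in> carrier (Aut M)"
  have s': "{x \<in> space M. rep h x \<noteq> rep k x} \<in> sets M"
    using neq_sets[OF M] r rep_in(1)[OF k] mp_bijD(2) by blast
  have "measure M {x \<in> space M. rep g x \<noteq> rep k x} \<le>
      measure M ({x \<in> space M. rep g x \<noteq> rep h x} \<union> {x \<in> space M. rep h x \<noteq> rep k x})"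
    using s s' by (intro finite_measure_mono) auto
  also have "\<dots> \<le> uniform_dist M g h + uniform_dist M h k"
    unfolding uniform_dist_def using s s' by (rule measure_Un_le)
  finally show "uniform_dist M g k \<le> uniform_dist M g h + uniform_dist M h k"
    by (simp add: uniform_dist_def)
qed

lemma AE_image_aut_class:
  assumes T: "T \<in> mp_bij M" and A: "A \<in> sets M"
  shows "AE x in M. x \<in> rep (aut_class M T) ` A \<longleftrightarrow> x \<in> T ` A"
proof -
  let ?S = "rep (aut_class M T)"
  have c: "aut_class M T \<in> carrier (Aut M)" using T by (simp add: Aut_def)
  note S = rep_in(1)[OF c]
  have "AE x in M. ?S (inv_into (space M) T x) = T (inv_into (space M) T x)"
    using AE_mp_bij[OF inv_mp_bij[OF T] rep_aut_class[OF T]] .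
  then show ?thesis
  proof (rule AE_mp, intro AE_I2 impI)
    fix x assume x: "x \<in> space M"
      and e: "?S (inv_into (space M) T x) = T (inv_into (space M) T x)"
    let ?y = "inv_into (space M) T x"
    have t: "T ?y = x" "?y \<in> space M"
      using x mp_bijD(1)[OF T] by (auto simp: bij_betw_def f_inv_into_f inv_into_into)
    have "inj_on T (space M)" "inj_on ?S (space M)" "A \<subseteq> space M"
      using mp_bijD(1)[OF T] mp_bijD(1)[OF S] sets.sets_into_space[OF A]
      by (auto simp: bij_betw_def)
    then have "x \<in> T ` A \<longleftrightarrow> ?y \<in> A" "x \<in> ?S ` A \<longleftrightarrow> ?y \<in> A"
      using t e by (metis inj_on_image_mem_iff)+
    then show "x \<in> ?S ` A \<longleftrightarrow> x \<in> T ` A" by simp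
  qed
qed

lemma topspace_weak_topology: "topspace (weak_topology M) = carrier (Aut M)"
proof -
  have *: "g \<in> {h \<in> carrier (Aut M). measure M (sym_diff (rep h ` {}) (rep g ` {})) < 1}"
    if "g \<in> carrier (Aut M)" for g
    using that by simp
  then show ?thesis
    unfolding weak_topology_def topology_generated_by_topspace
    using zero_less_one by (intro equalityI subsetI, blast) (rule UnionI[OF _ *], blast+)
qed

lemma limitin_weak_topology:
  assumes "prob_space M" and g: "g \<in> carrier (Aut M)" and h: "\<And>n. h n \<in> carrier (Aut M)"
  shows "limitin (weak_topology M) h g sequentially \<longleftrightarrow>
    (\<forall>A\<in>sets M. (\<lambda>n. measure M (sym_diff (rep (h n) ` A) (rep g ` A))) \<longlonglongrightarrow> 0)"
    (is "?L \<longleftrightarrow> ?R")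
proof
  interpret prob_space M by fact
  assume L: ?L
  show ?R
  proof
    fix A assume A: "A \<in> sets M"
    let ?f = "\<lambda>k. measure M (sym_diff (rep k ` A) (rep g ` A))"
    have "eventually (\<lambda>n. ?f (h n) < e) sequentially" if "0 < e" for e
    proof -
      have "openin (weak_topology M) {k \<in> carrier (Aut M). ?f k < e}"
        unfolding weak_topology_def using g A that
        by (intro topology_generated_by_Basis) blast
      then have "eventually (\<lambda>n. h n \<in> {k \<in> carrier (Aut M). ?f k < e}) sequentially"
        using L g that unfolding limitin_def by fastforce
      then show ?thesis by (rule eventually_mono) simp
    qed
    then show "(\<lambda>n. ?f (h n)) \<longlonglongrightarrow> 0"
      by (intro order_tendstoI)
        (auto intro!: always_eventually intro: less_le_trans[OF _ measure_nonneg])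
  qed
next
  interpret prob_space M by fact
  assume R: ?R
  have "eventually (\<lambda>n. h n \<in> U) sequentially"
    if "generate_topology_on
      {{h \<in> carrier (Aut M). measure M (sym_diff (rep h ` A) (rep g ` A)) < e} |g A e.
        g \<in> carrier (Aut M) \<and> A \<in> sets M \<and> 0 < e} U" "g \<in> U" for U
    using that
  proof (induction rule: generate_topology_on.induct)
    case (Int a b)
    then show ?case by (auto intro: eventually_conj)
  next
    case (UN K)
    then obtain k where "k \<in> K" "g \<in> k" by blast
    with UN have "eventually (\<lambda>n. h n \<in> k) sequentially" by blast
    then show ?case by (rule eventually_mono) (use \<open>k \<in> K\<close> in blast)
  next
    case (Basis s)
    then obtain g' A e where s: "g' \<in> carrier (Aut M)" "A \<in> sets M" "0 < e"
      "s = {h \<in> carrier (Aut M). measure M (sym_diff (rep h ` A) (rep g' ` A)) < e}" by blast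
    let ?d = "measure M (sym_diff (rep g ` A) (rep g' ` A))"
    have "?d < e" using Basis s by simp
    moreover have "(\<lambda>n. measure M (sym_diff (rep (h n) ` A) (rep g ` A))) \<longlonglongrightarrow> 0"
      using R s by blast
    ultimately have
      "eventually (\<lambda>n. measure M (sym_diff (rep (h n) ` A) (rep g ` A)) < e - ?d) sequentially"
      by (intro order_tendstoD(2)) auto
    then show ?case
    proof (rule eventually_mono)
      fix n assume n: "measure M (sym_diff (rep (h n) ` A) (rep g ` A)) < e - ?d"
      have m: "rep k ` A \<in> sets M" if "k \<in> carrier (Aut M)" for k
        using image_mp_bij(1) rep_in(1) s(2) that by blast
      have "measure M (sym_diff (rep (h n) ` A) (rep g' ` A)) \<le>
        measure M (sym_diff (rep (h n) ` A) (rep g ` A) \<union> sym_diff (rep g ` A) (rep g' ` A))"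
        using m[OF g] m[OF h[of n]] m[OF s(1)] by (intro finite_measure_mono) auto
      also have "\<dots> \<le> measure M (sym_diff (rep (h n) ` A) (rep g ` A)) + ?d"
        using m[OF g] m[OF h[of n]] m[OF s(1)] by (intro measure_Un_le) auto
      finally show "h n \<in> s" using n h s by auto
    qed
  qed simp
  then show ?L
    using g unfolding limitin_def topspace_weak_topology
    by (simp add: weak_topology_def openin_topology_generated_by_iff)
qed

end

theory Submission
  imports Defs
begin

text \<open>Everything rests on one closed graph principle: let \<open>\<tau>\<close> be a completely metrizable group topology on
  \<open>G\<close> and \<open>\<rho>\<close> a pseudometric such that countably many translates of suitable small sets cover \<open>G\<close>. By
  Baire category the \<open>\<tau>\<close>-closure of every \<open>\<rho>\<close>-ball around \<open>x\<close> is a \<open>\<tau>\<close>-neighbourhood of \<open>x\<close>, and if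
  rapidly \<open>\<rho>\<close>-Cauchy, \<open>\<tau>\<close>-convergent sequences have the right \<open>\<rho>\<close>-limit, then \<open>\<rho>\<close> is \<open>\<tau>\<close>-continuous.

  For the pseudometric \<open>\<mu>(gA \<triangle> hA)\<close> the limit condition follows because \<open>{g. gA \<subseteq> C}\<close> is \<open>\<tau>\<close>-closed:
  it says that \<open>g f g\<inverse>\<close> commutes with \<open>k\<close> whenever \<open>f\<close> is supported in \<open>A\<close> and \<open>k\<close> off \<open>C\<close>. So every
  completely metrizable group topology refines the weak topology. Hence limits with respect to two
  such topologies agree, and the closed graph principle, applied to a metric of a Polish group
  topology, shows that the latter is coarser than any other completely metrizable group topology,
  in particular than the uniform one and than any second Polish one.\<close>

section \<open>A closed graph principle\<close>

text \<open>The right-hand side is the exact value of the sum of \<open>e / 2 ^ (n + i)\<close> over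
  \<open>i < k\<close>. Keeping the subtracted term lets the induction close and later yields the
  strict bound \<open>2 * e / 2 ^ n\<close>.\<close>

lemma (in Metric_space) geometric_dist:
  assumes "\<And>n. s n \<in> M" and step: "\<And>n. d (s n) (s (Suc n)) < e / 2 ^ n"
  shows "d (s n) (s (n + k)) \<le> 2 * e / 2 ^ n - 2 * e / 2 ^ (n + k)"
proof (induction k)
  case (Suc k)
  have "d (s n) (s (n + Suc k)) \<le> d (s n) (s (n + k)) + d (s (n + k)) (s (n + Suc k))"
    using triangle assms(1) by blast
  also have "\<dots> \<le> (2 * e / 2 ^ n - 2 * e / 2 ^ (n + k)) + e / 2 ^ (n + k)"
    using Suc step[of "n + k"] by simp
  finally show ?case by (simp add: field_simps)
qed (simp add: assms)

lemma (in Metric_space) geometric_MCauchy: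
  assumes s: "\<And>n. s n \<in> M" and step: "\<And>n. d (s n) (s (Suc n)) < e / 2 ^ n"
  shows "MCauchy s"
  unfolding MCauchy_def
proof (intro conjI allI impI)
  show "range s \<subseteq> M" using s by blast
  fix \<epsilon> :: real assume \<epsilon>: "0 < \<epsilon>"
  have e: "0 < e" using le_less_trans[OF nonneg step[of 0]] by simp
  obtain N where N: "(1 / 2) ^ N < \<epsilon> / (4 * e)"
    using real_arch_pow_inv[of "\<epsilon> / (4 * e)" "1 / 2"] \<epsilon> e by auto
  have tl: "d (s N) (s n) < \<epsilon> / 2" if "N \<le> n" for n
  proof -
    obtain k where k: "n = N + k" using le_Suc_ex[OF \<open>N \<le> n\<close>] by auto
    have "2 * e / 2 ^ N < \<epsilon> / 2" using N e by (simp add: field_simps)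
    moreover have "0 < 2 * e / (2::real) ^ (N + k)" using e by simp
    ultimately show ?thesis using geometric_dist[OF assms, of N k] unfolding k by linarith
  qed
  have "d (s n) (s n') < \<epsilon>" if "N \<le> n" "N \<le> n'" for n n'
  proof -
    have "d (s n) (s n') \<le> d (s n) (s N) + d (s N) (s n')"
      using triangle s by blast
    then show ?thesis using tl[OF that(1)] tl[OF that(2)] commute[of "s n" "s N"] by linarith
  qed
  then show "\<exists>N. \<forall>n n'. N \<le> n \<longrightarrow> N \<le> n' \<longrightarrow> d (s n) (s n') < \<epsilon>" by blast
qed

lemma (in Metric_space) MCauchy_geometric_subsequence:
  assumes s: "MCauchy s"
  shows "\<exists>r. strict_mono (r :: nat \<Rightarrow> nat) \<and> (\<forall>n. d (s (r n)) (s (r (Suc n))) < 1 / 2 ^ n)"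
proof -
  define P where "P n k \<longleftrightarrow> (\<forall>m\<ge>k. \<forall>m'\<ge>k. d (s m) (s m') < 1 / 2 ^ n)" for n k :: nat
  have ex: "\<exists>k. P n k" for n
    using s unfolding MCauchy_def P_def by (meson divide_pos_pos zero_less_numeral zero_less_one zero_less_power)
  have "\<exists>r. \<forall>n. P n (r n) \<and> r n < r (Suc n)"
  proof (rule dependent_nat_choice)
    show "\<exists>k. P 0 k" by (rule ex)
    fix k n
    obtain l where "P (Suc n) l" using ex by blast
    then have "P (Suc n) (max l (Suc k))" by (simp add: P_def)
    then show "\<exists>l. P (Suc n) l \<and> k < l" by (intro exI[of _ "max l (Suc k)"]) simp
  qed
  then obtain r where r: "\<And>n. P n (r n)" "\<And>n. r n < r (Suc n)" by blast
  have "d (s (r n)) (s (r (Suc n))) < 1 / 2 ^ n" for n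
    using r(1)[of n] less_imp_le[OF r(2)[of n]] by (simp add: P_def)
  then show ?thesis using r(2) strict_mono_Suc_iff by blast
qed

text \<open>Starting from \<open>z\<^sub>0 = x\<close> and \<open>z\<^sub>1 = y\<close> choose \<open>z\<^sub>n\<^sub>+\<^sub>2\<close> \<open>\<rho>\<close>-close to \<open>z\<^sub>n\<close> and \<open>d\<close>-close to \<open>z\<^sub>n\<^sub>+\<^sub>1\<close>. The even
  and the odd terms are both \<open>\<rho>\<close>-Cauchy with the same \<open>d\<close>-limit.\<close>

lemma (in Metric_space) almost_continuous_imp_continuous:
  fixes \<rho> :: "'a \<Rightarrow> 'a \<Rightarrow> real"
  assumes complete: mcomplete
    and sym: "\<And>x y. x \<in> M \<Longrightarrow> y \<in> M \<Longrightarrow> \<rho> x y = \<rho> y x"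
    and tri: "\<And>x y z. x \<in> M \<Longrightarrow> y \<in> M \<Longrightarrow> z \<in> M \<Longrightarrow> \<rho> x z \<le> \<rho> x y + \<rho> y z"
    and almost: "\<And>x e. x \<in> M \<Longrightarrow> 0 < e \<Longrightarrow>
      \<exists>\<delta>>0. mball x \<delta> \<subseteq> mtopology closure_of {y \<in> M. \<rho> x y < e}"
    and closed_graph: "\<And>s x e. limitin mtopology s x sequentially \<Longrightarrow> (\<And>n. s n \<in> M) \<Longrightarrow>
      0 < e \<Longrightarrow> (\<And>n. \<rho> (s n) (s (Suc n)) < e / 2 ^ n) \<Longrightarrow> \<rho> (s 0) x \<le> 4 * e"
    and x: "x \<in> M" and e: "0 < e"
  shows "\<exists>\<delta>>0. \<forall>y\<in>mball x \<delta>. \<rho> x y < e"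
proof -
  \<comment> \<open>The limit condition will cost \<open>4 * c\<close> on the side of
    \<open>x\<close> and \<open>4 * c\<close> on the side of \<open>y\<close>; ten parts leave room
    for a strict inequality.\<close>
  define c where "c = e / 10"
  have c: "0 < c" using e by (simp add: c_def)
  define r where "r n = c / 2 ^ n" for n :: nat
  have r: "0 < r n" for n using c by (simp add: r_def)
  obtain \<delta> where \<delta>: "\<delta> > 0" "mball x \<delta> \<subseteq> mtopology closure_of {y \<in> M. \<rho> x y < r 0}"
    using almost[OF x r] by blast
  have "\<rho> x y < e" if y: "y \<in> mball x \<delta>" for y
  proof -
    \<comment> \<open>The state of the recursion is the pair of consecutive terms
      \<open>(z n, z (Suc n))\<close>. Its invariant, that the second lies in the closure of the
      \<rho>-ball of radius \<open>r n\<close> around the first, is what allows the next choice; at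
      stage 0 the pair is pinned to \<open>(x, y)\<close>.\<close>
    define P where "P n p \<longleftrightarrow> fst p \<in> M \<and> snd p \<in> M \<and>
      snd p \<in> mtopology closure_of {y \<in> M. \<rho> (fst p) y < r n} \<and> (n = 0 \<longrightarrow> p = (x, y))"
      for n :: nat and p
    define Q where "Q n p q \<longleftrightarrow> fst q = snd p \<and> \<rho> (fst p) (snd q) < r n \<and>
      d (snd p) (snd q) < 1 / 2 ^ n" for n :: nat and p q :: "'a \<times> 'a"
    have "\<exists>f. \<forall>n. P n (f n) \<and> Q n (f n) (f (Suc n))"
    proof (rule dependent_nat_choice)
      show "\<exists>p. P 0 p"
        using x y \<delta> by (intro exI[of _ "(x, y)"]) (auto simp: P_def)
    next
      fix p n assume p: "P n p"
      obtain a b where ab: "p = (a, b)" by force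
      have ab': "a \<in> M" "b \<in> M" "b \<in> mtopology closure_of {y \<in> M. \<rho> a y < r n}"
        using p by (auto simp: P_def ab)
      obtain \<eta> where \<eta>: "\<eta> > 0" "mball b \<eta> \<subseteq> mtopology closure_of {y \<in> M. \<rho> b y < r (Suc n)}"
        using almost[OF ab'(2) r] by blast
      \<comment> \<open>The bound \<eta> preserves the invariant for the pair \<open>(b, z)\<close>,
        and \<open>1 / 2 ^ n\<close> makes the whole sequence \<open>d\<close>-Cauchy.\<close>
      have "0 < min \<eta> (1 / 2 ^ n)" using \<eta> by simp
      with ab'(3) obtain z where z: "z \<in> M" "\<rho> a z < r n" "z \<in> mball b (min \<eta> (1 / 2 ^ n))"
        unfolding metric_closure_of by blast
      have "P (Suc n) (b, z)" "Q n p (b, z)"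
        using z ab' \<eta> ab by (auto simp: P_def Q_def)
      then show "\<exists>q. P (Suc n) q \<and> Q n p q" by blast
    qed
    then obtain f where f: "\<And>n. P n (f n)" "\<And>n. Q n (f n) (f (Suc n))" by blast
    define z where "z n = fst (f n)" for n
    have z1: "snd (f n) = z (Suc n)" for n using f(2)[of n] by (simp add: Q_def z_def)
    have zM: "z n \<in> M" for n using f(1)[of n] by (simp add: P_def z_def)
    have z0: "z 0 = x" "z (Suc 0) = y" using f(1)[of 0] z1[of 0] by (auto simp: P_def z_def)
    have z\<rho>: "\<rho> (z n) (z (Suc (Suc n))) < r n" for n
      using f(2)[of n] z1[of "Suc n"] by (simp add: Q_def z_def)
    have zd: "d (z (Suc n)) (z (Suc (Suc n))) < 1 / 2 ^ n" for n
      using f(2)[of n] z1[of n] z1[of "Suc n"] by (simp add: Q_def)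
    have "MCauchy (z \<circ> Suc)"
      using zM zd by (intro geometric_MCauchy[of _ 1]) auto
    then obtain w where w: "limitin mtopology (z \<circ> Suc) w sequentially"
      using complete by (auto simp: mcomplete_def)
    then have w: "limitin mtopology z w sequentially"
      using limitin_sequentially_offset_rev[of mtopology z 1 w] by (simp add: o_def)
    have wM: "w \<in> M" using w limitin_mspace by blast
    \<comment> \<open>Used for \<open>i = 0\<close>, the even terms starting at \<open>x\<close>,
      and for \<open>i = 1\<close>, the odd terms starting at \<open>y\<close>.\<close>
    have lim: "limitin mtopology (z \<circ> (\<lambda>n. i + 2 * n)) w sequentially" for i
      using w by (intro limitin_subsequence) (auto simp: strict_mono_def)
    have rle: "r (i + 2 * n) \<le> c / 2 ^ n" for i n
      unfolding r_def using c by (intro divide_left_mono) (auto intro!: power_increasing)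
    have half: "\<rho> (z i) w \<le> 4 * c" for i
    proof -
      have "\<rho> ((z \<circ> (\<lambda>n. i + 2 * n)) 0) w \<le> 4 * c"
        using closed_graph[OF lim[of i] _ c] zM order.strict_trans2[OF z\<rho> rle] by simp
      then show ?thesis by simp
    qed
    have "\<rho> x y \<le> \<rho> x w + \<rho> w y" using tri x wM zM[of "Suc 0"] z0 by metis
    also have "\<dots> \<le> 8 * c" using half[of 0] half[of "Suc 0"] sym[OF wM zM[of "Suc 0"]] z0 by simp
    also have "\<dots> < e" using e by (simp add: c_def)
    finally show ?thesis .
  qed
  then show ?thesis using \<delta> by blast
qed

section \<open>Continuity of group words and Baire category in topological groups\<close>

lemma group_topology_continuous:
  assumes \<tau>: "group_topology H \<tau>"
  shows group_topology_mult: "continuous_map \<sigma> \<tau> f \<Longrightarrow> continuous_map \<sigma> \<tau> g \<Longrightarrow>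
      continuous_map \<sigma> \<tau> (\<lambda>w. f w \<otimes>\<^bsub>H\<^esub> g w)"
    and group_topology_inv: "continuous_map \<sigma> \<tau> f \<Longrightarrow> continuous_map \<sigma> \<tau> (\<lambda>w. inv\<^bsub>H\<^esub> (f w))"
    and group_topology_const: "b \<in> carrier H \<Longrightarrow> continuous_map \<sigma> \<tau> (\<lambda>w. b)"
proof -
  have mul: "continuous_map (prod_topology \<tau> \<tau>) \<tau> (\<lambda>(x, y). x \<otimes>\<^bsub>H\<^esub> y)"
    and inv: "continuous_map \<tau> \<tau> (\<lambda>x. inv\<^bsub>H\<^esub> x)"
    using \<tau> by (auto simp: group_topology_def)
  show "continuous_map \<sigma> \<tau> (\<lambda>w. f w \<otimes>\<^bsub>H\<^esub> g w)"
    if "continuous_map \<sigma> \<tau> f" "continuous_map \<sigma> \<tau> g"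
    using continuous_map_compose[OF continuous_map_pairedI[OF that] mul] by (simp add: o_def)
  show "continuous_map \<sigma> \<tau> (\<lambda>w. inv\<^bsub>H\<^esub> (f w))" if "continuous_map \<sigma> \<tau> f"
    using continuous_map_compose[OF that inv] by (simp add: o_def)
  show "continuous_map \<sigma> \<tau> (\<lambda>w. b)" if "b \<in> carrier H"
    using that \<tau> by (simp add: group_topology_def)
qed

text \<open>Countably many closures of translates \<open>a V\<close> cover a Baire space, so one of
  them has an interior point \<open>p\<close>. For \<open>w\<close> near \<open>x\<close> both
  \<open>p\<close> and \<open>p x\<inverse> w\<close> lie in the closure of \<open>a V\<close>;
  their quotient is \<open>x\<inverse> w\<close>, and
  \<open>(a V)\<inverse> (a V) = V\<inverse> V\<close>.\<close>

lemma baire_translates: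
  fixes H :: "('g, 'm) monoid_scheme"
  assumes H: "group H" and \<tau>: "group_topology H \<tau>" and cm: "completely_metrizable_space \<tau>"
    and V: "V \<subseteq> carrier H"
    and D: "countable D" "D \<subseteq> carrier H"
    and cover: "carrier H \<subseteq> (\<Union>a\<in>D. (\<lambda>v. a \<otimes>\<^bsub>H\<^esub> v) ` V)"
    and x: "x \<in> carrier H"
  shows "\<exists>W. openin \<tau> W \<and> x \<in> W \<and>
    W \<subseteq> \<tau> closure_of {x \<otimes>\<^bsub>H\<^esub> (inv\<^bsub>H\<^esub> u \<otimes>\<^bsub>H\<^esub> v) |u v. u \<in> V \<and> v \<in> V}"
proof -
  interpret group H by fact
  have top: "topspace \<tau> = carrier H" using \<tau> by (simp add: group_topology_def)
  let ?T = "\<lambda>a. (\<lambda>v. a \<otimes>\<^bsub>H\<^esub> v) ` V"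
  have "\<exists>a\<in>D. \<tau> interior_of (\<tau> closure_of ?T a) \<noteq> {}"
  proof (rule ccontr)
    assume "\<not> ?thesis"
    then have "\<tau> interior_of (\<Union>a\<in>D. \<tau> closure_of ?T a) = {}"
      using cm D by (intro Baire_category_alt) auto
    moreover have "carrier H \<subseteq> (\<Union>a\<in>D. \<tau> closure_of ?T a)"
    proof
      fix y assume "y \<in> carrier H"
      then obtain a where "a \<in> D" "y \<in> ?T a" using cover by blast
      moreover have "?T a \<subseteq> \<tau> closure_of ?T a"
        using \<open>a \<in> D\<close> D V top by (intro closure_of_subset) auto
      ultimately show "y \<in> (\<Union>a\<in>D. \<tau> closure_of ?T a)" by blast
    qed
    then have "\<tau> interior_of carrier H \<subseteq> \<tau> interior_of (\<Union>a\<in>D. \<tau> closure_of ?T a)"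
      by (rule interior_of_mono)
    ultimately show False using x top interior_of_topspace[of \<tau>] by auto
  qed
  then obtain a p where a: "a \<in> D" and p: "p \<in> \<tau> interior_of (\<tau> closure_of ?T a)" by blast
  let ?O = "\<tau> interior_of (\<tau> closure_of ?T a)"
  have pH: "p \<in> carrier H" using subsetD[OF interior_of_subset_topspace p] top by simp
  have aH: "a \<in> carrier H" using a D by blast
  \<comment> \<open>The homeomorphism sending \<open>x\<close> to \<open>p\<close> pulls the
    interior back to a neighbourhood of \<open>x\<close>.\<close>
  define W where "W = {w \<in> carrier H. p \<otimes>\<^bsub>H\<^esub> (inv\<^bsub>H\<^esub> x \<otimes>\<^bsub>H\<^esub> w) \<in> ?O}"
  have "continuous_map \<tau> \<tau> (\<lambda>w. p \<otimes>\<^bsub>H\<^esub> (inv\<^bsub>H\<^esub> x \<otimes>\<^bsub>H\<^esub> w))"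
    using pH x continuous_map_id[of \<tau>] by (intro group_topology_continuous[OF \<tau>] inv_closed) (simp_all add: id_def)
  then have "openin \<tau> W"
    unfolding W_def top[symmetric] by (rule openin_continuous_map_preimage) simp
  moreover have "x \<in> W" using x pH p by (simp add: W_def)
  moreover have "W \<subseteq> \<tau> closure_of {x \<otimes>\<^bsub>H\<^esub> (inv\<^bsub>H\<^esub> u \<otimes>\<^bsub>H\<^esub> v) |u v. u \<in> V \<and> v \<in> V}" (is "_ \<subseteq> ?R")
  proof
    fix w assume w: "w \<in> W"
    let ?f = "\<lambda>q. x \<otimes>\<^bsub>H\<^esub> (inv\<^bsub>H\<^esub> (fst q) \<otimes>\<^bsub>H\<^esub> snd q)"
    let ?q = "p \<otimes>\<^bsub>H\<^esub> (inv\<^bsub>H\<^esub> x \<otimes>\<^bsub>H\<^esub> w)"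
    have f: "continuous_map (prod_topology \<tau> \<tau>) \<tau> ?f"
      using x by (intro group_topology_continuous[OF \<tau>] continuous_map_fst continuous_map_snd)
    have "?O \<subseteq> \<tau> closure_of ?T a" by (rule interior_of_subset)
    then have "(p, ?q) \<in> prod_topology \<tau> \<tau> closure_of (?T a \<times> ?T a)"
      using p w by (auto simp: closure_of_Times W_def)
    then have "?f (p, ?q) \<in> \<tau> closure_of (?f ` (?T a \<times> ?T a))"
      using continuous_map_image_closure_subset[OF f] by blast
    moreover have "?f (p, ?q) = w"
      using pH x w by (simp add: W_def m_assoc[symmetric])
    moreover have "?f ` (?T a \<times> ?T a) \<subseteq> {x \<otimes>\<^bsub>H\<^esub> (inv\<^bsub>H\<^esub> u \<otimes>\<^bsub>H\<^esub> v) |u v. u \<in> V \<and> v \<in> V}"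
    proof clarsimp
      fix u v assume uv: "u \<in> V" "v \<in> V"
      \<comment> \<open>The translating element \<open>a\<close> cancels in the quotient.\<close>
      then have c: "u \<in> carrier H" "v \<in> carrier H" using V by auto
      have "inv\<^bsub>H\<^esub> (a \<otimes>\<^bsub>H\<^esub> u) \<otimes>\<^bsub>H\<^esub> (a \<otimes>\<^bsub>H\<^esub> v) = inv\<^bsub>H\<^esub> u \<otimes>\<^bsub>H\<^esub> (inv\<^bsub>H\<^esub> a \<otimes>\<^bsub>H\<^esub> (a \<otimes>\<^bsub>H\<^esub> v))"
        using c aH by (simp add: inv_mult_group m_assoc)
      also have "\<dots> = inv\<^bsub>H\<^esub> u \<otimes>\<^bsub>H\<^esub> v"
        using c aH by (simp add: m_assoc[symmetric])
      finally show "\<exists>ua va. x \<otimes>\<^bsub>H\<^esub> (inv\<^bsub>H\<^esub> (a \<otimes>\<^bsub>H\<^esub> u) \<otimes>\<^bsub>H\<^esub> (a \<otimes>\<^bsub>H\<^esub> v)) =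
        x \<otimes>\<^bsub>H\<^esub> (inv\<^bsub>H\<^esub> ua \<otimes>\<^bsub>H\<^esub> va) \<and> ua \<in> V \<and> va \<in> V" using uv by metis
    qed
    then have "\<tau> closure_of (?f ` (?T a \<times> ?T a)) \<subseteq> ?R" by (rule closure_of_mono)
    ultimately show "w \<in> ?R" by auto
  qed
  ultimately show ?thesis by blast
qed

text \<open>Baire category puts a neighbourhood of \<open>x\<close> into the closure of
  \<open>x V\<inverse> V\<close>, which the covering hypothesis places inside a \<rho>-ball; this is
  the almost continuity required for a complete metric of \<tau>. Invariance of \<rho> is not among
  the hypotheses, so \<open>V\<close> may depend on \<open>x\<close>.\<close>

theorem closed_graph_pseudometric:
  fixes H :: "('g, 'm) monoid_scheme" and \<rho> :: "'g \<Rightarrow> 'g \<Rightarrow> real"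
  assumes H: "group H" and \<tau>: "group_topology H \<tau>" and cm: "completely_metrizable_space \<tau>"
    and sym: "\<And>x y. x \<in> carrier H \<Longrightarrow> y \<in> carrier H \<Longrightarrow> \<rho> x y = \<rho> y x"
    and tri: "\<And>x y z. x \<in> carrier H \<Longrightarrow> y \<in> carrier H \<Longrightarrow> z \<in> carrier H \<Longrightarrow>
      \<rho> x z \<le> \<rho> x y + \<rho> y z"
    and cover: "\<And>x e. x \<in> carrier H \<Longrightarrow> 0 < e \<Longrightarrow>
      \<exists>V D. V \<subseteq> carrier H \<and> countable D \<and> D \<subseteq> carrier H \<and>
        carrier H \<subseteq> (\<Union>a\<in>D. (\<lambda>v. a \<otimes>\<^bsub>H\<^esub> v) ` V) \<and>
        (\<forall>u\<in>V. \<forall>v\<in>V. \<rho> x (x \<otimes>\<^bsub>H\<^esub> (inv\<^bsub>H\<^esub> u \<otimes>\<^bsub>H\<^esub> v)) < e)"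
    and closed_graph: "\<And>s x e. limitin \<tau> s x sequentially \<Longrightarrow> (\<And>n. s n \<in> carrier H) \<Longrightarrow>
      0 < e \<Longrightarrow> (\<And>n. \<rho> (s n) (s (Suc n)) < e / 2 ^ n) \<Longrightarrow> \<rho> (s 0) x \<le> 4 * e"
    and x: "x \<in> carrier H" and e: "0 < e"
  shows "\<exists>W. openin \<tau> W \<and> x \<in> W \<and> (\<forall>y\<in>W. \<rho> x y < e)"
proof -
  interpret group H by fact
  obtain Y d where Y: "Metric_space Y d" "Metric_space.mcomplete Y d" "\<tau> = Metric_space.mtopology Y d"
    using cm by (auto simp: completely_metrizable_space_def)
  interpret Y: Metric_space Y d by fact
  have Y_eq: "Y = carrier H" using \<tau> Y(3) by (simp add: group_topology_def)
  have "\<exists>\<delta>>0. Y.mball x \<delta> \<subseteq> Y.mtopology closure_of {y \<in> Y. \<rho> x y < e}"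
    if x: "x \<in> Y" and e: "0 < e" for x e
  proof -
    obtain V D where VD: "V \<subseteq> carrier H" "countable D" "D \<subseteq> carrier H"
        "carrier H \<subseteq> (\<Union>a\<in>D. (\<lambda>v. a \<otimes>\<^bsub>H\<^esub> v) ` V)"
        and V: "\<forall>u\<in>V. \<forall>v\<in>V. \<rho> x (x \<otimes>\<^bsub>H\<^esub> (inv\<^bsub>H\<^esub> u \<otimes>\<^bsub>H\<^esub> v)) < e"
      using cover[OF x[unfolded Y_eq] e] by (elim exE conjE) blast
    let ?R = "{x \<otimes>\<^bsub>H\<^esub> (inv\<^bsub>H\<^esub> u \<otimes>\<^bsub>H\<^esub> v) |u v. u \<in> V \<and> v \<in> V}"
    obtain W where W: "openin \<tau> W" "x \<in> W" "W \<subseteq> \<tau> closure_of ?R"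
      using baire_translates[OF H \<tau> cm VD x[unfolded Y_eq]] by (elim exE conjE)
    then obtain \<delta> where \<delta>: "\<delta> > 0" "Y.mball x \<delta> \<subseteq> W"
      unfolding Y(3) Y.openin_mtopology by blast
    have "?R \<subseteq> {y \<in> Y. \<rho> x y < e}"
      using V VD(1) x by (auto simp: Y_eq subset_iff)
    then have "\<tau> closure_of ?R \<subseteq> \<tau> closure_of {y \<in> Y. \<rho> x y < e}"
      by (rule closure_of_mono)
    with \<delta> W(3) show ?thesis unfolding Y(3) by blast
  qed
  then obtain \<delta> where "\<delta> > 0" "\<forall>y\<in>Y.mball x \<delta>. \<rho> x y < e"
    using Y.almost_continuous_imp_continuous[of \<rho> x e] Y(2) sym tri closed_graph x e
    unfolding Y_eq Y(3) by blast
  then show ?thesis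
    using x unfolding Y_eq[symmetric] Y(3) by (intro exI[of _ "Y.mball x \<delta>"]) auto
qed

text \<open>The previous theorem is applied with a complete metric \<open>d\<close> of \<sigma> in
  place of \<rho>. Separability of \<sigma> gives the countable cover by translates. A rapidly
  \<open>d\<close>-Cauchy sequence has a \<sigma>-limit by completeness, and \<open>unique\<close>
  identifies it with the \<tau>-limit.\<close>

theorem closed_graph_polish:
  fixes H :: "('g, 'm) monoid_scheme"
  assumes H: "group H" and \<tau>: "group_topology H \<tau>" and cm: "completely_metrizable_space \<tau>"
    and \<sigma>: "polish_group_topology H \<sigma>"
    and unique: "\<And>s x z. (\<And>n. s n \<in> carrier H) \<Longrightarrow> limitin \<tau> s x sequentially \<Longrightarrow>
      limitin \<sigma> s z sequentially \<Longrightarrow> x = z"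
    and U: "openin \<sigma> U"
  shows "openin \<tau> U"
proof -
  interpret group H by fact
  have \<sigma>g: "group_topology H \<sigma>" and sep: "separable_space \<sigma>" "completely_metrizable_space \<sigma>"
    using \<sigma> by (auto simp: polish_group_topology_def polish_topology_def)
  obtain Y d where Y: "Metric_space Y d" "Metric_space.mcomplete Y d" "\<sigma> = Metric_space.mtopology Y d"
    using sep by (auto simp: completely_metrizable_space_def)
  interpret Y: Metric_space Y d by fact
  have Y_eq: "Y = carrier H" using \<sigma>g Y(3) by (simp add: group_topology_def)
  obtain D where D: "countable D" "D \<subseteq> carrier H" "\<sigma> closure_of D = carrier H"
    using sep(1) \<sigma>g unfolding separable_space_def group_topology_def by metis
  have ball: "\<exists>W. openin \<tau> W \<and> x \<in> W \<and> (\<forall>y\<in>W. d x y < e)"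
    if x: "x \<in> carrier H" and e: "0 < e" for x e
  proof (rule closed_graph_pseudometric[OF H \<tau> cm _ _ _ _ x e])
    fix x y z assume "x \<in> carrier H" "y \<in> carrier H" "z \<in> carrier H"
    then show "d x z \<le> d x y + d y z" using Y.triangle Y_eq by blast
  next
    fix x y show "d x y = d y x" by (rule Y.commute)
  next
    fix x and e :: real assume x: "x \<in> carrier H" and e: "0 < e"
    let ?f = "\<lambda>q. x \<otimes>\<^bsub>H\<^esub> (inv\<^bsub>H\<^esub> (fst q) \<otimes>\<^bsub>H\<^esub> snd q)"
    \<comment> \<open>\<open>?f\<close> sends the pair of identities to \<open>x\<close>, so the
      open set \<open>S\<close> contains a square \<open>?V \<times> ?V\<close> around that
      pair.\<close>
    define S where "S = {q \<in> topspace (prod_topology \<sigma> \<sigma>). ?f q \<in> Y.mball x e}"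
    have "continuous_map (prod_topology \<sigma> \<sigma>) \<sigma> ?f"
      using x by (intro group_topology_continuous[OF \<sigma>g] continuous_map_fst continuous_map_snd)
    then have S: "openin (prod_topology \<sigma> \<sigma>) S"
      by (unfold S_def, rule openin_continuous_map_preimage) (simp add: Y(3))
    have 1: "(\<one>\<^bsub>H\<^esub>, \<one>\<^bsub>H\<^esub>) \<in> S"
      using x e x[folded Y_eq] one_closed[folded Y_eq] by (simp add: Y(3) S_def)
    obtain A B where AB: "openin \<sigma> A" "openin \<sigma> B" "\<one>\<^bsub>H\<^esub> \<in> A" "\<one>\<^bsub>H\<^esub> \<in> B"
      "A \<times> B \<subseteq> S"
      using S[unfolded openin_prod_topology_alt, rule_format, OF 1] by (elim exE conjE)
    let ?V = "A \<inter> B"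
    have V: "openin \<sigma> ?V" "\<one>\<^bsub>H\<^esub> \<in> ?V" "?V \<subseteq> carrier H"
      using AB openin_subset[OF AB(1)] \<sigma>g by (auto simp: group_topology_def)
    have "carrier H \<subseteq> (\<Union>a\<in>D. (\<lambda>v. a \<otimes>\<^bsub>H\<^esub> v) ` ?V)"
    proof
      fix g assume g: "g \<in> carrier H"
      \<comment> \<open>The elements whose translate of \<open>?V\<close> contains \<open>g\<close>
        form an open set around \<open>g\<close>, hence one of them lies in the dense set
        \<open>D\<close>.\<close>
      define T where "T = {a \<in> topspace \<sigma>. inv\<^bsub>H\<^esub> a \<otimes>\<^bsub>H\<^esub> g \<in> ?V}"
      have "continuous_map \<sigma> \<sigma> (\<lambda>a. inv\<^bsub>H\<^esub> a \<otimes>\<^bsub>H\<^esub> g)"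
        using g continuous_map_id[of \<sigma>]
        by (intro group_topology_continuous[OF \<sigma>g]) (simp_all add: id_def)
      then have "openin \<sigma> T"
        unfolding T_def using V(1) by (rule openin_continuous_map_preimage)
      moreover have "g \<in> T"
        using g g[folded Y_eq] V(2) by (simp add: Y(3) T_def)
      moreover have "g \<in> \<sigma> closure_of D" using g D(3) by simp
      ultimately have "\<exists>a. a \<in> D \<and> a \<in> T"
        by (auto simp: in_closure_of)
      then obtain a where a: "a \<in> D" "inv\<^bsub>H\<^esub> a \<otimes>\<^bsub>H\<^esub> g \<in> ?V"
        by (auto simp: T_def)
      have "g = a \<otimes>\<^bsub>H\<^esub> (inv\<^bsub>H\<^esub> a \<otimes>\<^bsub>H\<^esub> g)"
        using a(1) D(2) g by (simp add: m_assoc[symmetric] subset_iff)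
      with a show "g \<in> (\<Union>a\<in>D. (\<lambda>v. a \<otimes>\<^bsub>H\<^esub> v) ` ?V)" by blast
    qed
    moreover have "\<forall>u\<in>?V. \<forall>v\<in>?V. d x (x \<otimes>\<^bsub>H\<^esub> (inv\<^bsub>H\<^esub> u \<otimes>\<^bsub>H\<^esub> v)) < e"
      using AB(5) by (auto simp: subset_iff S_def)
    ultimately show "\<exists>V D. V \<subseteq> carrier H \<and> countable D \<and> D \<subseteq> carrier H \<and>
        carrier H \<subseteq> (\<Union>a\<in>D. (\<lambda>v. a \<otimes>\<^bsub>H\<^esub> v) ` V) \<and>
        (\<forall>u\<in>V. \<forall>v\<in>V. d x (x \<otimes>\<^bsub>H\<^esub> (inv\<^bsub>H\<^esub> u \<otimes>\<^bsub>H\<^esub> v)) < e)"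
      using V(3) D(1,2) by (intro exI[of _ ?V] exI[of _ D]) simp
  next
    fix s x and e :: real
    assume lim: "limitin \<tau> s x sequentially" and s: "\<And>n. s n \<in> carrier H" and e: "0 < e"
      and fast: "\<And>n. d (s n) (s (Suc n)) < e / 2 ^ n"
    have sY: "s n \<in> Y" for n using s Y_eq by simp
    obtain z where z: "limitin \<sigma> s z sequentially"
      using Y.geometric_MCauchy[OF sY fast] Y(2) by (auto simp: Y.mcomplete_def Y(3))
    have x: "limitin Y.mtopology s x sequentially" using z unique[OF s lim z] Y(3) by simp
    then have xY: "x \<in> Y" by (rule Y.limitin_mspace)
    obtain n where n: "d (s n) x < e"
      using x e unfolding Y.limitin_metric by (auto simp: eventually_sequentially)
    have "d (s 0) x \<le> d (s 0) (s n) + d (s n) x" using Y.triangle sY xY by blast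
    moreover have "0 < 2 * e / 2 ^ n" using e by simp
    then have "d (s 0) (s n) < 2 * e" using Y.geometric_dist[OF sY fast, of 0 n] by simp
    ultimately show "d (s 0) x \<le> 4 * e" using n e by linarith
  qed
  have "\<exists>W. openin \<tau> W \<and> x \<in> W \<and> W \<subseteq> U" if x: "x \<in> U" for x
  proof -
    have UY: "U \<subseteq> carrier H" using openin_subset[OF U] \<sigma>g by (simp add: group_topology_def)
    obtain e where e: "0 < e" "Y.mball x e \<subseteq> U"
      using U x unfolding Y(3) Y.openin_mtopology by blast
    obtain W where W: "openin \<tau> W" "x \<in> W" "\<forall>y\<in>W. d x y < e"
      using ball[of x e] UY x e(1) by blast
    have "W \<subseteq> carrier H" using openin_subset[OF W(1)] \<tau> by (simp add: group_topology_def)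
    then have "W \<subseteq> Y.mball x e"
      using W(3) x UY unfolding Y_eq[symmetric] by (simp add: Y.in_mball subset_iff)
    then have "W \<subseteq> U" using e(2) by (rule subset_trans)
    with W show ?thesis by blast
  qed
  then show ?thesis by (subst openin_subopen) blast
qed

section \<open>Automorphisms and their supports\<close>

text \<open>Elements of \<open>mp_bij\<close> are bijective everywhere, whereas limits and pasted
  maps are invertible only almost everywhere. The exceptional null set is enlarged to a null set
  whose complement is mapped into itself by \<open>T\<close> and \<open>S\<close>, and
  \<open>T\<close> is replaced by the identity on it.\<close>

lemma ae_invertible_mp_bij:
  assumes T: "T \<in> measurable M M" and S: "S \<in> measurable M M" and d: "distr M M T = M"
    and ST: "AE x in M. S (T x) = x" and TS: "AE x in M. T (S x) = x"
  shows "\<exists>R\<in>mp_bij M. AE x in M. R x = T x"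
proof -
  have "distr M M S = distr (distr M M T) M S" using d by simp
  also have "\<dots> = distr M M (S \<circ> T)" by (rule distr_distr[OF S T])
  also have "\<dots> = distr M M (\<lambda>x. x)"
    using ST measurable_comp[OF T S] by (intro distr_cong_AE) auto
  also have "\<dots> = M" by (simp add: distr_id)
  finally have d': "distr M M S = M" .
  have null: "F -` A \<inter> space M \<in> null_sets M"
    if F: "F \<in> measurable M M" "distr M M F = M" and A: "A \<in> null_sets M" for F A
    using A emeasure_distr[OF F(1), of A] F measurable_sets[OF F(1)] by (auto simp: null_sets_def)
  have "AE x in M. S (T x) = x \<and> T (S x) = x" using ST TS by auto
  then obtain N where N: "N \<in> null_sets M" "{x \<in> space M. \<not> (S (T x) = x \<and> T (S x) = x)} \<subseteq> N"
    by (auto simp: eventually_ae_filter)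
  \<comment> \<open>Iterated preimages of the bad set. A point outside their union stays outside
    under \<open>T\<close> and \<open>S\<close>, and the union is null because both maps preserve
    the measure.\<close>
  define B where "B = rec_nat N (\<lambda>_ A. A \<union> (T -` A \<inter> space M) \<union> (S -` A \<inter> space M))"
  have B0: "B 0 = N" and BS: "B (Suc k) = B k \<union> (T -` B k \<inter> space M) \<union> (S -` B k \<inter> space M)" for k
    by (simp_all add: B_def)
  have Bnull: "B k \<in> null_sets M" for k
    by (induction k) (auto simp: B0 BS N intro!: null_sets.Un null[OF T d] null[OF S d'])
  define U where "U = (\<Union>k. B k)"
  have U: "U \<in> null_sets M" unfolding U_def using Bnull by (rule null_sets_UN)
  have stable: "T x \<notin> U" "S x \<notin> U" "S (T x) = x" "T (S x) = x"
    if "x \<in> space M" "x \<notin> U" for x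
  proof -
    show "T x \<notin> U" "S x \<notin> U"
      using that BS unfolding U_def by blast+
    have "x \<notin> N" using that B0 unfolding U_def by blast
    then show "S (T x) = x" "T (S x) = x" using N(2) that by blast+
  qed
  define R where "R x = (if x \<in> U then x else T x)" for x
  define R' where "R' x = (if x \<in> U then x else S x)" for x
  have Us: "U \<in> sets M" using U by auto
  have R: "R \<in> measurable M M" "R' \<in> measurable M M"
    unfolding R_def R'_def using T S Us by (auto intro!: measurable_If_set)
  note sp = measurable_space[OF T] measurable_space[OF S]
  have RR: "R' (R x) = x" "R (R' x) = x" if "x \<in> space M" for x
    using stable[OF that] by (auto simp: R_def R'_def)
  have bij: "bij_betw R (space M) (space M)"
    using RR measurable_space[OF R(1)] measurable_space[OF R(2)]
    by (intro bij_betw_byWitness[of _ R']) (simp_all add: image_subset_iff)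
  have "inv_into (space M) R x = R' x" if "x \<in> space M" for x
    using bij RR that measurable_space[OF R(2) that]
    by (intro inv_into_f_eq) (auto simp: bij_betw_def)
  then have "inv_into (space M) R \<in> measurable M M"
    using R(2) by (subst measurable_cong) auto
  moreover have ae: "AE x in M. R x = T x"
    using AE_not_in[OF U] by (auto simp: R_def)
  then have "distr M M R = M"
    using distr_cong_AE[OF refl refl ae, of M] R(1) T d by simp
  ultimately have "R \<in> mp_bij M" using bij R(1) by (simp add: mp_bij_def)
  with ae show ?thesis by blast
qed

section \<open>Almost everywhere identities for representatives\<close>

lemma rep_mult:
  assumes "g \<in> carrier (Aut M)" "h \<in> carrier (Aut M)"
  shows "AE x in M. rep (g \<otimes>\<^bsub>Aut M\<^esub> h) x = rep g (rep h x)"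
  using rep_aut_class[OF comp_mp_bij[OF rep_in(1)[OF assms(1)] rep_in(1)[OF assms(2)]]]
  by (simp add: Aut_def)

lemma rep_one: "AE x in M. rep \<one>\<^bsub>Aut M\<^esub> x = x"
  using rep_aut_class[OF id_mp_bij[of M]] by (simp add: Aut_def)

lemma rep_eqI:
  assumes "g \<in> carrier (Aut M)" "h \<in> carrier (Aut M)" "AE x in M. rep g x = rep h x"
  shows "g = h"
  using aut_class_eq_iff[OF rep_in(1)[OF assms(1)] rep_in(1)[OF assms(2)]] assms
    rep_in(2)[OF assms(1)] rep_in(2)[OF assms(2)] by simp

lemma AE_rep:
  assumes "g \<in> carrier (Aut M)" "AE x in M. P x"
  shows "AE x in M. P (rep g x)"
  using AE_mp_bij[OF rep_in(1)[OF assms(1)] assms(2)] .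

lemma rep_inv_left:
  assumes g: "g \<in> carrier (Aut M)"
  shows "AE x in M. rep (inv\<^bsub>Aut M\<^esub> g) (rep g x) = x"
proof -
  interpret Aut: group "Aut M" by (rule group_Aut)
  show ?thesis using rep_mult[OF Aut.inv_closed[OF g] g] rep_one[of M] g by auto
qed

lemma rep_inv_right:
  assumes g: "g \<in> carrier (Aut M)"
  shows "AE x in M. rep g (rep (inv\<^bsub>Aut M\<^esub> g) x) = x"
proof -
  interpret Aut: group "Aut M" by (rule group_Aut)
  show ?thesis using rep_mult[OF g Aut.inv_closed[OF g]] rep_one[of M] g by auto
qed

lemma rep_measurable: "g \<in> carrier (Aut M) \<Longrightarrow> rep g \<in> measurable M M"
  using rep_in(1) mp_bijD(2) by blast

lemma rep_inj:
  assumes "g \<in> carrier (Aut M)" "x \<in> space M" "y \<in> space M"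
  shows "rep g x = rep g y \<longleftrightarrow> x = y"
  using mp_bijD(1)[OF rep_in(1)[OF assms(1)]] assms by (auto simp: bij_betw_def inj_on_def)

lemma measure_rep_vimage:
  assumes g: "g \<in> carrier (Aut M)" and A: "{x \<in> space M. P x} \<in> sets M"
  shows "measure M {x \<in> space M. P (rep g x)} = measure M {x \<in> space M. P x}"
proof -
  have "measure M {x \<in> space M. P (rep g x)} = measure M (rep g -` {x \<in> space M. P x} \<inter> space M)"
    using measurable_space[OF rep_measurable[OF g]] by (intro arg_cong[where f="measure M"]) auto
  then show ?thesis
    using measure_distr[OF rep_measurable[OF g] A] mp_bijD(4)[OF rep_in(1)[OF g]] by simp
qed

lemma rep_image_mem_iff:
  assumes "g \<in> carrier (Aut M)" "x \<in> space M" "A \<in> sets M"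
  shows "rep g x \<in> rep g ` A \<longleftrightarrow> x \<in> A"
  using mp_bijD(1)[OF rep_in(1)[OF assms(1)]] assms(2) sets.sets_into_space[OF assms(3)]
  by (intro inj_on_image_mem_iff) (auto simp: bij_betw_def)

text \<open>\<open>B\<close> ranges over arbitrary sets, so complements \<open>- C\<close> in the
  whole type and comprehensions such as \<open>{x. rep g x \<in> C}\<close> can be used
  directly.\<close>

definition supported_in :: "'a measure \<Rightarrow> 'a set \<Rightarrow> ('a \<Rightarrow> 'a) set \<Rightarrow> bool" where
  "supported_in M B g \<longleftrightarrow> (AE x in M. x \<notin> B \<longrightarrow> rep g x = x)"

lemma supported_in_mono:
  assumes "supported_in M B g" "AE x in M. x \<in> B \<longrightarrow> x \<in> C"
  shows "supported_in M C g"
  using assms unfolding supported_in_def by auto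

text \<open>If \<open>g x\<close> were outside \<open>B\<close>, then \<open>g\<close> would fix
  \<open>g x\<close>, and injectivity would force \<open>g x = x\<close>.\<close>

lemma supported_in_invariant:
  assumes "g \<in> carrier (Aut M)" "supported_in M B g"
  shows "AE x in M. x \<in> B \<longrightarrow> rep g x \<in> B"
  using AE_rep[OF assms(1) assms(2)[unfolded supported_in_def]] AE_space
proof eventually_elim
  case (elim x)
  then show ?case
    using rep_inj[OF assms(1) measurable_space[OF rep_measurable[OF assms(1)]]] by metis
qed

text \<open>For \<open>x\<close> outside \<open>C\<close> the point \<open>g\<inverse> x\<close>
  avoids \<open>A\<close>, since otherwise \<open>x = g (g\<inverse> x)\<close> would lie in
  \<open>C\<close>; hence \<open>h\<close> fixes it.\<close>

lemma supported_in_conj: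
  assumes g: "g \<in> carrier (Aut M)" and h: "h \<in> carrier (Aut M)" and "supported_in M A h"
    and AC: "AE x in M. x \<in> A \<longrightarrow> rep g x \<in> C"
  shows "supported_in M C (g \<otimes>\<^bsub>Aut M\<^esub> h \<otimes>\<^bsub>Aut M\<^esub> inv\<^bsub>Aut M\<^esub> g)"
proof -
  interpret Aut: group "Aut M" by (rule group_Aut)
  let ?i = "inv\<^bsub>Aut M\<^esub> g"
  have i: "?i \<in> carrier (Aut M)" using g by simp
  show ?thesis
    unfolding supported_in_def
    using rep_mult[OF Aut.m_closed[OF g h] i] AE_rep[OF i rep_mult[OF g h]] rep_inv_right[OF g]
      AE_rep[OF i AC] AE_rep[OF i assms(3)[unfolded supported_in_def]]
  proof eventually_elim
    case (elim x)
    then show ?case by metis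
  qed
qed

text \<open>Only \<open>f\<close> moves points of \<open>C\<close> and only \<open>k\<close> moves
  points outside, and each maps its own piece into itself.\<close>

lemma supported_in_commute:
  assumes f: "f \<in> carrier (Aut M)" and k: "k \<in> carrier (Aut M)"
    and "supported_in M C f" "supported_in M (- C) k"
  shows "f \<otimes>\<^bsub>Aut M\<^esub> k = k \<otimes>\<^bsub>Aut M\<^esub> f"
proof -
  interpret Aut: group "Aut M" by (rule group_Aut)
  show ?thesis
  proof (rule rep_eqI[of _ M])
    show "AE x in M. rep (f \<otimes>\<^bsub>Aut M\<^esub> k) x = rep (k \<otimes>\<^bsub>Aut M\<^esub> f) x"
      using rep_mult[OF f k] rep_mult[OF k f] assms(3,4)[unfolded supported_in_def]
        supported_in_invariant[OF f assms(3)] supported_in_invariant[OF k assms(4)]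
        AE_rep[OF k assms(3)[unfolded supported_in_def]] AE_rep[OF f assms(4)[unfolded supported_in_def]]
    proof eventually_elim
      case (elim x)
      then show ?case by (cases "x \<in> C") auto
    qed
  qed (use f k in auto)
qed

section \<open>Separability of the measure algebra\<close>

lemma (in finite_measure) measure_sym_diff_triangle:
  assumes "A \<in> sets M" "B \<in> sets M" "C \<in> sets M"
  shows "measure M (sym_diff A C) \<le> measure M (sym_diff A B) + measure M (sym_diff B C)"
proof -
  have "measure M (sym_diff A C) \<le> measure M (sym_diff A B \<union> sym_diff B C)"
    using assms by (intro finite_measure_mono) auto
  also have "\<dots> \<le> measure M (sym_diff A B) + measure M (sym_diff B C)"
    using assms by (intro measure_Un_le) auto
  finally show ?thesis .
qed

text \<open>The generators are closed under complements and finite unions, which keeps them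
  countable. The sets approximable by this algebra form a sigma-algebra, countable unions being
  approximated by finite ones through continuity from below.\<close>

lemma (in finite_measure) countable_dense_algebra:
  assumes gen: "countable \<E>" "\<E> \<subseteq> Pow (space M)" "sets M = sigma_sets (space M) \<E>"
  shows "\<exists>\<K>. countable \<K> \<and> \<K> \<subseteq> sets M \<and>
    (\<forall>A\<in>sets M. \<forall>e>0. \<exists>K\<in>\<K>. measure M (sym_diff A K) < e)"
proof -
  \<comment> \<open>Stage \<open>Suc n\<close> adds the complements and binary unions of stage
    \<open>n\<close>; the stages increase, so their union is an algebra.\<close>
  define F where "F = rec_nat (insert {} \<E>)
    (\<lambda>_ S. S \<union> (\<lambda>A. space M - A) ` S \<union> (\<lambda>(A, B). A \<union> B) ` (S \<times> S))"
  have F0: "F 0 = insert {} \<E>" and FS: "F (Suc n) =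
      F n \<union> (\<lambda>A. space M - A) ` F n \<union> (\<lambda>(A, B). A \<union> B) ` (F n \<times> F n)" for n
    by (simp_all add: F_def)
  define \<K> where "\<K> = (\<Union>n. F n)"
  have "countable (F n)" for n
    by (induction n) (auto simp: F0 FS gen(1) intro!: countable_SIGMA)
  then have ctb: "countable \<K>" by (simp add: \<K>_def)
  have "\<E> \<subseteq> sets M" unfolding gen(3) by (auto intro: sigma_sets.Basic)
  then have "F n \<subseteq> sets M" for n
    by (induction n) (auto simp: F0 FS subset_iff)
  then have \<K>: "\<K> \<subseteq> sets M" by (auto simp: \<K>_def)
  have mono: "F m \<subseteq> F n" if "m \<le> n" for m n
    using that by (induction rule: dec_induct) (auto simp: FS)
  have compl: "space M - A \<in> \<K>" if A: "A \<in> \<K>" for A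
  proof -
    obtain n where "A \<in> F n" using A by (auto simp: \<K>_def)
    then have "space M - A \<in> F (Suc n)" by (simp add: FS)
    then show ?thesis unfolding \<K>_def by blast
  qed
  have un: "A \<union> B \<in> \<K>" if AB: "A \<in> \<K>" "B \<in> \<K>" for A B
  proof -
    obtain m n where "A \<in> F m" "B \<in> F n" using AB by (auto simp: \<K>_def)
    then have "A \<in> F (max m n)" "B \<in> F (max m n)"
      using mono[of m "max m n"] mono[of n "max m n"] by auto
    then have "A \<union> B \<in> F (Suc (max m n))" unfolding FS by force
    then show ?thesis unfolding \<K>_def by blast
  qed
  define approx where "approx A \<longleftrightarrow> A \<in> sets M \<and> (\<forall>e>0. \<exists>K\<in>\<K>. measure M (sym_diff A K) < e)" for A
  have Kapprox: "approx K" if "K \<in> \<K>" for K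
    using that \<K> by (auto simp: approx_def intro!: bexI[of _ K])
  have E: "{} \<in> \<K>" "\<E> \<subseteq> \<K>"
    using F0 unfolding \<K>_def by blast+
  have approx_un: "approx (A \<union> B)" if A: "approx A" and B: "approx B" for A B
    unfolding approx_def
  proof (intro conjI allI impI)
    show "A \<union> B \<in> sets M" using A B by (auto simp: approx_def)
    fix e :: real assume "0 < e"
    then have "0 < e / 2" by simp
    then obtain K L where K: "K \<in> \<K>" "measure M (sym_diff A K) < e / 2"
      and L: "L \<in> \<K>" "measure M (sym_diff B L) < e / 2"
      using A B unfolding approx_def by meson
    have s: "A \<in> sets M" "B \<in> sets M" "K \<in> sets M" "L \<in> sets M"
      using A B K L \<K> by (auto simp: approx_def)
    have "measure M (sym_diff (A \<union> B) (K \<union> L)) \<le> measure M (sym_diff A K \<union> sym_diff B L)"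
      using s by (intro finite_measure_mono) auto
    also have "\<dots> \<le> measure M (sym_diff A K) + measure M (sym_diff B L)"
      using s by (intro measure_Un_le) auto
    also have "\<dots> < e" using K L by simp
    finally show "\<exists>K\<in>\<K>. measure M (sym_diff (A \<union> B) K) < e"
      using un[OF K(1) L(1)] by blast
  qed
  have "approx A" if "A \<in> sigma_sets (space M) \<E>" for A
    using that
  proof (induction rule: sigma_sets.induct)
    case (Basic a)
    then show ?case using Kapprox E by blast
  next
    case Empty
    show ?case using Kapprox E by blast
  next
    case (Compl a)
    show ?case
      unfolding approx_def
    proof (intro conjI allI impI)
      have a: "a \<in> sets M" using Compl by (simp add: approx_def)
      then show "space M - a \<in> sets M" by simp
      fix e :: real assume "0 < e"
      then obtain K where K: "K \<in> \<K>" "measure M (sym_diff a K) < e"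
        using Compl unfolding approx_def by blast
      have "sym_diff (space M - a) (space M - K) = sym_diff a K"
        using sets.sets_into_space[OF a] sets.sets_into_space[of K M] K(1) \<K> by auto
      with K compl show "\<exists>K\<in>\<K>. measure M (sym_diff (space M - a) K) < e"
        by (metis (no_types))
    qed
  next
    case (Union a)
    have part: "approx (\<Union>i<n. a i)" for n
    proof (induction n)
      case 0
      then show ?case using Kapprox E by simp
    next
      case (Suc n)
      have "(\<Union>i<Suc n. a i) = a n \<union> (\<Union>i<n. a i)" by (auto simp: less_Suc_eq)
      then show ?case using approx_un[OF Union.IH[of n] Suc] by simp
    qed
    have as: "a i \<in> sets M" for i using Union.IH by (simp add: approx_def)
    show ?case
      unfolding approx_def
    proof (intro conjI allI impI)
      show s: "\<Union>(range a) \<in> sets M" using as by blast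
      fix e :: real assume e: "0 < e"
      have "incseq (\<lambda>n. \<Union>i<n. a i)" by (intro incseq_SucI UN_mono) auto
      then have "(\<lambda>n. measure M (\<Union>i<n. a i)) \<longlonglongrightarrow> measure M (\<Union>n. \<Union>i<n. a i)"
        using as by (intro finite_Lim_measure_incseq) auto
      moreover have "(\<Union>n. \<Union>i<n. a i) = \<Union>(range a)" by auto
      ultimately have "(\<lambda>n. measure M (\<Union>i<n. a i)) \<longlonglongrightarrow> measure M (\<Union>(range a))" by simp
      then have "eventually (\<lambda>n. measure M (\<Union>(range a)) - e / 2 < measure M (\<Union>i<n. a i)) sequentially"
        using e by (intro order_tendstoD(1)) auto
      then obtain n where n: "measure M (\<Union>(range a)) - e / 2 < measure M (\<Union>i<n. a i)"
        by (auto simp: eventually_sequentially)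
      have sn: "(\<Union>i<n. a i) \<in> sets M" using part[of n] by (simp add: approx_def)
      have sub: "(\<Union>i<n. a i) \<subseteq> \<Union>(range a)" by auto
      then have "sym_diff (\<Union>(range a)) (\<Union>i<n. a i) = \<Union>(range a) - (\<Union>i<n. a i)" by auto
      then have "measure M (sym_diff (\<Union>(range a)) (\<Union>i<n. a i)) =
          measure M (\<Union>(range a)) - measure M (\<Union>i<n. a i)"
        by (simp only: finite_measure_Diff[OF s sn sub])
      then have d: "measure M (sym_diff (\<Union>(range a)) (\<Union>i<n. a i)) < e / 2"
        using n by linarith
      have "0 < e / 2" using e by simp
      then obtain K where K: "K \<in> \<K>" "measure M (sym_diff (\<Union>i<n. a i) K) < e / 2"
        using part[of n] unfolding approx_def by blast
      have "measure M (sym_diff (\<Union>(range a)) K) < e"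
        using measure_sym_diff_triangle[OF s sn, of K] K d \<K> by auto
      with K show "\<exists>K\<in>\<K>. measure M (sym_diff (\<Union>(range a)) K) < e" by blast
    qed
  qed
  then have "\<forall>A\<in>sets M. \<forall>e>0. \<exists>K\<in>\<K>. measure M (sym_diff A K) < e"
    unfolding gen(3) approx_def by blast
  with ctb \<K> show ?thesis by blast
qed

text \<open>The generators are the balls with centres in a countable dense set and rational radii;
  every open set is the countable union of those it contains.\<close>

lemma standard_borel_countably_generated:
  assumes "standard_borel_space M"
  shows "\<exists>\<E>. countable \<E> \<and> \<E> \<subseteq> Pow (space M) \<and> sets M = sigma_sets (space M) \<E>"
proof -
  obtain X where X: "separable_space X" "completely_metrizable_space X"
    "topspace X = space M" "sets M = sigma_sets (space M) {U. openin X U}"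
    using assms by (auto simp: standard_borel_space_def polish_topology_def)
  obtain Y d where Y: "Metric_space Y d" "X = Metric_space.mtopology Y d"
    using completely_metrizable_imp_metrizable_space[OF X(2)]
    by (auto simp: metrizable_space_def)
  interpret Metric_space Y d by fact
  have Y_eq: "Y = space M" using Y(2) X(3) by simp
  obtain D where D: "countable D" "D \<subseteq> Y" "mtopology closure_of D = Y"
    using X(1) Y(2) by (auto simp: separable_space_def)
  let ?\<E> = "(\<lambda>(c, r). mball c r) ` (D \<times> (\<rat> :: real set))"
  have ctb: "countable ?\<E>" using D(1) countable_rat by (intro countable_image countable_SIGMA) auto
  have sub: "?\<E> \<subseteq> Pow (space M)" unfolding Y_eq[symmetric] using mball_subset_mspace by auto
  have "U \<in> sigma_sets (space M) ?\<E>" if U: "openin X U" for U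
  proof -
    let ?S = "{E \<in> ?\<E>. E \<subseteq> U}"
    have cover: "\<exists>E\<in>?S. x \<in> E" if x: "x \<in> U" for x
    proof -
      obtain r where r: "0 < r" "mball x r \<subseteq> U" and xY: "x \<in> Y"
        using U x unfolding Y(2) openin_mtopology by blast
      have "x \<in> mtopology closure_of D" using xY D(3) by simp
      then obtain c where c: "c \<in> D" "c \<in> mball x (r / 2)"
        using r(1) unfolding metric_closure_of by (auto dest: spec[of _ "r / 2"])
      then have cs: "c \<in> Y" "d c x < r / 2" using commute by auto
      obtain q where q: "q \<in> \<rat>" "d c x < q" "q < r / 2"
        using Rats_dense_in_real[OF cs(2)] by blast
      have "mball c q \<subseteq> mball x r"
      proof
        fix y assume y: "y \<in> mball c q"
        then have "d x y \<le> d x c + d c y" using triangle xY cs(1) by auto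
        then show "y \<in> mball x r" using y xY cs q commute[of x c] by auto
      qed
      then have "mball c q \<in> ?S" using r(2) c(1) q(1) by auto
      moreover have "x \<in> mball c q" using cs xY q by simp
      ultimately show ?thesis by (intro bexI[of _ "mball c q"])
    qed
    have "U = \<Union>?S"
    proof
      show "U \<subseteq> \<Union>?S" using cover by (simp only: subset_iff Union_iff) blast
    qed blast
    moreover have "\<Union>?S \<in> sigma_sets (space M) ?\<E>"
      by (rule sigma_sets_UNION)
        (use ctb in \<open>auto intro: countable_subset[OF _ ctb] sigma_sets.Basic\<close>)
    ultimately show ?thesis by simp
  qed
  then have "sigma_sets (space M) {U. openin X U} \<subseteq> sigma_sets (space M) ?\<E>"
    by (intro sigma_sets_mono) auto
  moreover have "sigma_sets (space M) ?\<E> \<subseteq> sigma_sets (space M) {U. openin X U}"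
    using Y(2) openin_mball by (intro sigma_sets_mono) (auto intro: sigma_sets.Basic)
  ultimately show ?thesis using ctb sub X(4) by (intro exI[of _ ?\<E>]) blast
qed

text \<open>The sets that do not distinguish \<open>y\<close> from \<open>z\<close> form a
  sigma-algebra containing the generators, while the Hausdorff property gives an open set that
  distinguishes distinct points.\<close>

lemma standard_borel_separates:
  assumes M: "standard_borel_space M" and \<E>: "\<E> \<subseteq> Pow (space M)" "sets M = sigma_sets (space M) \<E>"
    and yz: "y \<in> space M" "z \<in> space M" and same: "\<And>E. E \<in> \<E> \<Longrightarrow> y \<in> E \<longleftrightarrow> z \<in> E"
  shows "y = z"
proof (rule ccontr)
  assume ne: "y \<noteq> z"
  obtain X where X: "completely_metrizable_space X"
    "topspace X = space M" "sets M = sigma_sets (space M) {U. openin X U}"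
    using M by (auto simp: standard_borel_space_def polish_topology_def)
  have "Hausdorff_space X"
    using X(1) completely_metrizable_imp_metrizable_space metrizable_imp_Hausdorff_space by blast
  then have "\<exists>U V. openin X U \<and> openin X V \<and> y \<in> U \<and> z \<in> V \<and> disjnt U V"
    using yz ne X(2) unfolding Hausdorff_space_def by simp
  then obtain U where U: "openin X U" "y \<in> U" "z \<notin> U"
    by (auto simp: disjnt_iff)
  have "U \<in> sigma_sets (space M) \<E>"
    using U(1) X(3) \<E>(2) by (metis mem_Collect_eq sigma_sets.Basic)
  moreover have "y \<in> E \<longleftrightarrow> z \<in> E" if "E \<in> sigma_sets (space M) \<E>" for E
    using that by induction (use same yz in auto)
  ultimately show False using U by blast
qed

section \<open>Ergodic full groups\<close>

locale ergodic_full_group =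
  fixes M :: "'a measure" and G :: "('a \<Rightarrow> 'a) set set"
  assumes std: "standard_prob_space M" and full: "full_group M G" and erg: "ergodic_group M G"
begin

section \<open>Pasting and swapping inside the full group\<close>

sublocale prob_space M
  using std by (simp add: standard_prob_space_def)

sublocale Aut: group "Aut M"
  by (rule group_Aut)

lemma borel: "standard_borel_space M"
  using std by (simp add: standard_prob_space_def)

lemma subgroup_G: "subgroup G (Aut M)"
  using full by (simp add: full_group_def)

lemma G_carrier [intro]: "g \<in> G \<Longrightarrow> g \<in> carrier (Aut M)"
  using subgroup.subset[OF subgroup_G] by blast

lemma G_closed [intro]:
  shows "\<one>\<^bsub>Aut M\<^esub> \<in> G" "g \<in> G \<Longrightarrow> inv\<^bsub>Aut M\<^esub> g \<in> G"
    "g \<in> G \<Longrightarrow> h \<in> G \<Longrightarrow> g \<otimes>\<^bsub>Aut M\<^esub> h \<in> G"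
  using subgroup_G by (auto intro: subgroup.one_closed subgroup.m_inv_closed subgroup.m_closed)

lemma G_rep_measurable: "g \<in> G \<Longrightarrow> rep g \<in> measurable M M"
  using rep_measurable G_carrier by blast

lemma glue:
  assumes "\<And>n :: nat. T n \<in> G" "\<And>n. A n \<in> sets M" "disjoint_family A" "(\<Union>n. A n) = space M"
    and "S \<in> carrier (Aut M)" "\<And>n. AE x in M. x \<in> A n \<longrightarrow> rep S x = rep (T n) x"
  shows "S \<in> G"
proof -
  have "\<forall>(T :: nat \<Rightarrow> ('a \<Rightarrow> 'a) set) (A :: nat \<Rightarrow> 'a set). \<forall>S\<in>carrier (Aut M).
        (\<forall>n. T n \<in> G) \<longrightarrow> (\<forall>n. A n \<in> sets M) \<longrightarrow> disjoint_family A \<longrightarrow>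
        (\<Union>n. A n) = space M \<longrightarrow>
        (\<forall>n. AE x in M. x \<in> A n \<longrightarrow> rep S x = rep (T n) x) \<longrightarrow> S \<in> G"
    using full by (simp add: full_group_def)
  from this[rule_format, of S T A] show ?thesis using assms by simp
qed

text \<open>The involution acts as \<open>g\<close> on \<open>C\<close>, as
  \<open>g\<inverse>\<close> on the image of \<open>C\<close>, and trivially elsewhere. It is pasted
  from three elements of \<open>G\<close>. The set \<open>{x. rep (inv g) x \<in> C}\<close> is the
  image of \<open>C\<close> up to a null set.\<close>

lemma exists_swap:
  assumes g: "g \<in> G" and C: "C \<in> sets M" and disj: "AE x in M. x \<in> C \<longrightarrow> rep g x \<notin> C"
  shows "\<exists>h\<in>G. (AE x in M. x \<in> C \<longrightarrow> rep h x = rep g x) \<and>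
    supported_in M (C \<union> {x. rep (inv\<^bsub>Aut M\<^esub> g) x \<in> C}) h"
proof -
  let ?i = "inv\<^bsub>Aut M\<^esub> g"
  have gc: "g \<in> carrier (Aut M)" and ic: "?i \<in> carrier (Aut M)" and i: "?i \<in> G" using g by auto
  define a where "a = rep g"
  define b where "b = rep ?i"
  have [measurable]: "a \<in> measurable M M" "b \<in> measurable M M" "C \<in> sets M"
    using G_rep_measurable g i C by (auto simp: a_def b_def)
  have ba: "AE x in M. b (a x) = x" and ab: "AE x in M. a (b x) = x"
    using rep_inv_left[OF gc] rep_inv_right[OF gc] by (auto simp: a_def b_def)
  have aC: "AE x in M. x \<in> C \<longrightarrow> a x \<notin> C" using disj by (simp add: a_def)
  have bC: "AE x in M. x \<in> C \<longrightarrow> b x \<notin> C"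
    using AE_rep[OF ic aC] ab by eventually_elim (auto simp: b_def)
  \<comment> \<open>As \<open>C\<close> and its image are disjoint up to a null set,
    \<open>T\<close> is an involution almost everywhere and serves as its own inverse below.\<close>
  define T where "T x = (if x \<in> C then a x else if b x \<in> C then b x else x)" for x
  have Tm [measurable]: "T \<in> measurable M M" unfolding T_def by measurable
  have TT: "AE x in M. T (T x) = x"
    using ba ab aC bC AE_rep[OF ic bC, folded b_def] by eventually_elim (auto simp: T_def)
  have "distr M M T = M"
  proof (rule measure_eqI)
    fix B assume "B \<in> sets (distr M M T)"
    then have B [measurable]: "B \<in> sets M" by simp
    \<comment> \<open>The preimage of \<open>B\<close> is \<open>?P\<close> on \<open>C\<close>,
      \<open>?Q\<close> on the image of \<open>C\<close>, and \<open>?R\<close> elsewhere.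
      Precomposition with \<open>b\<close> matches \<open>?P\<close> with \<open>?P'\<close> and
      \<open>?Q\<close> with \<open>?Q'\<close>; removing \<open>C\<close> makes the unions exactly
      disjoint at the price of a null set.\<close>
    let ?P = "{x \<in> space M. x \<in> C \<and> a x \<in> B}"
    let ?Q = "{x \<in> space M. b x \<in> C \<and> b x \<in> B}"
    let ?R = "{x \<in> space M. x \<notin> C \<and> b x \<notin> C \<and> x \<in> B}"
    let ?P' = "{x \<in> space M. b x \<in> C \<and> x \<in> B}"
    let ?Q' = "{x \<in> space M. x \<in> C \<and> x \<in> B}"
    have m: "?P \<in> sets M" "?Q - C \<in> sets M" "?R \<in> sets M" "?P' - C \<in> sets M" "?Q' \<in> sets M"
      by measurable
    have "measure M (?P \<union> (?Q - C)) = measure M ?P + measure M (?Q - C)"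
      using m by (intro finite_measure_Union) auto
    moreover have "measure M (?P \<union> (?Q - C) \<union> ?R) = measure M (?P \<union> (?Q - C)) + measure M ?R"
      using m by (intro finite_measure_Union) (auto intro!: sets.Un)
    ultimately have split1: "measure M (?P \<union> (?Q - C) \<union> ?R) = measure M ?P + measure M (?Q - C) + measure M ?R"
      by simp
    have "measure M ((?P' - C) \<union> ?Q') = measure M (?P' - C) + measure M ?Q'"
      using m by (intro finite_measure_Union) auto
    moreover have "measure M ((?P' - C) \<union> ?Q' \<union> ?R) = measure M ((?P' - C) \<union> ?Q') + measure M ?R"
      using m by (intro finite_measure_Union) (auto intro!: sets.Un)
    ultimately have split2: "measure M (?P' - C) + measure M ?Q' + measure M ?R = measure M ((?P' - C) \<union> ?Q' \<union> ?R)"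
      by simp
    have "measure M (T -` B \<inter> space M) = measure M (?P \<union> (?Q - C) \<union> ?R)"
      by (intro arg_cong[where f="measure M"]) (auto simp: T_def split: if_splits)
    also have "\<dots> = measure M ?P + measure M (?Q - C) + measure M ?R"
      by (rule split1)
    also have "measure M ?P = measure M {x \<in> space M. b x \<in> C \<and> a (b x) \<in> B}"
      using measure_rep_vimage[OF ic, of "\<lambda>x. x \<in> C \<and> a x \<in> B"] by (simp add: b_def)
    also have "\<dots> = measure M (?P' - C)"
      using ab bC by (intro finite_measure_eq_AE) auto
    also have "measure M (?Q - C) = measure M ?Q"
      using bC by (intro finite_measure_eq_AE) auto
    also have "\<dots> = measure M ?Q'"
      using measure_rep_vimage[OF ic, of "\<lambda>x. x \<in> C \<and> x \<in> B"] by (simp add: b_def)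
    also have "measure M (?P' - C) + measure M ?Q' + measure M ?R = measure M ((?P' - C) \<union> ?Q' \<union> ?R)"
      by (rule split2)
    also have "(?P' - C) \<union> ?Q' \<union> ?R = B"
      using sets.sets_into_space[OF B] by auto
    finally show "emeasure (distr M M T) B = emeasure M B"
      by (simp add: emeasure_distr emeasure_eq_measure)
  qed simp
  then obtain R where R: "R \<in> mp_bij M" "AE x in M. R x = T x"
    using ae_invertible_mp_bij[OF Tm Tm _ TT TT] by blast
  define h where "h = aut_class M R"
  have hc: "h \<in> carrier (Aut M)" using R(1) by (simp add: h_def Aut_def)
  have hT: "AE x in M. rep h x = T x"
    using rep_aut_class[OF R(1)] R(2) by (auto simp: h_def)
  \<comment> \<open>A partition into three pieces, continued by empty sets to fit the countable form
    of the pasting condition.\<close>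
  define A where "A n = (if n = 0 then C else if n = 1 then {x \<in> space M. x \<notin> C \<and> b x \<in> C}
    else if n = 2 then {x \<in> space M. x \<notin> C \<and> b x \<notin> C} else {})" for n :: nat
  define F where "F n = (if n = 0 then g else if n = 1 then ?i else \<one>\<^bsub>Aut M\<^esub>)" for n :: nat
  have "h \<in> G"
  proof (rule glue[of F A])
    show "F n \<in> G" for n using g by (auto simp: F_def)
    show "A n \<in> sets M" for n by (simp add: A_def C)
    show "disjoint_family A" by (auto simp: disjoint_family_on_def A_def)
    show "(\<Union>n. A n) = space M"
    proof
      show "(\<Union>n. A n) \<subseteq> space M" using sets.sets_into_space[OF C] by (auto simp: A_def split: if_splits)
      have "x \<in> A 0 \<union> A 1 \<union> A 2" if "x \<in> space M" for x
        using that by (auto simp: A_def)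
      then show "space M \<subseteq> (\<Union>n. A n)" by blast
    qed
    show "AE x in M. x \<in> A n \<longrightarrow> rep h x = rep (F n) x" for n
      using hT rep_one[of M]
      by eventually_elim (auto simp: A_def F_def T_def a_def b_def)
  qed (rule hc)
  moreover have "AE x in M. x \<in> C \<longrightarrow> rep h x = rep g x"
    using hT by eventually_elim (auto simp: T_def a_def)
  moreover have "supported_in M (C \<union> {x. rep ?i x \<in> C}) h"
    unfolding supported_in_def using hT by eventually_elim (auto simp: T_def b_def)
  ultimately show ?thesis by blast
qed

section \<open>The pseudometric given by the images of a fixed set\<close>

definition img_dist :: "'a set \<Rightarrow> ('a \<Rightarrow> 'a) set \<Rightarrow> ('a \<Rightarrow> 'a) set \<Rightarrow> real" where
  "img_dist A g h = measure M (sym_diff (rep g ` A) (rep h ` A))"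

lemma img:
  assumes "g \<in> carrier (Aut M)" "A \<in> sets M"
  shows img_sets: "rep g ` A \<in> sets M" and img_measure: "measure M (rep g ` A) = measure M A"
  using image_mp_bij[OF rep_in(1)[OF assms(1)] assms(2)] by auto

lemma AE_img_mult:
  assumes "g \<in> carrier (Aut M)" "h \<in> carrier (Aut M)" "A \<in> sets M"
  shows "AE x in M. x \<in> rep (g \<otimes>\<^bsub>Aut M\<^esub> h) ` A \<longleftrightarrow> x \<in> rep g ` rep h ` A"
  using AE_image_aut_class[OF comp_mp_bij[OF rep_in(1)[OF assms(1)] rep_in(1)[OF assms(2)]] assms(3)]
  by (simp add: Aut_def image_comp)

lemma img_dist_sym: "img_dist A g h = img_dist A h g"
  by (simp add: img_dist_def Un_commute)

lemma img_dist_triangle: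
  assumes "A \<in> sets M" "g \<in> carrier (Aut M)" "h \<in> carrier (Aut M)" "k \<in> carrier (Aut M)"
  shows "img_dist A g k \<le> img_dist A g h + img_dist A h k"
  unfolding img_dist_def using assms by (intro measure_sym_diff_triangle img_sets)

text \<open>\<open>k\<close> is injective and preserves the measure, so it carries one symmetric
  difference onto the other up to a null set.\<close>

lemma img_dist_mult_left:
  assumes A: "A \<in> sets M" and g: "g \<in> carrier (Aut M)" and h: "h \<in> carrier (Aut M)"
    and k: "k \<in> carrier (Aut M)"
  shows "img_dist A (k \<otimes>\<^bsub>Aut M\<^esub> g) (k \<otimes>\<^bsub>Aut M\<^esub> h) = img_dist A g h"
proof -
  note s = img_sets[OF g A] img_sets[OF h A]
  have inj: "inj_on (rep k) (space M)"
    using mp_bijD(1)[OF rep_in(1)[OF k]] by (simp add: bij_betw_def)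
  note sub = s[THEN sets.sets_into_space]
  have "img_dist A (k \<otimes>\<^bsub>Aut M\<^esub> g) (k \<otimes>\<^bsub>Aut M\<^esub> h) =
      measure M (sym_diff (rep k ` rep g ` A) (rep k ` rep h ` A))"
    unfolding img_dist_def
  proof (rule finite_measure_eq_AE)
    show "AE x in M. x \<in> sym_diff (rep (k \<otimes>\<^bsub>Aut M\<^esub> g) ` A) (rep (k \<otimes>\<^bsub>Aut M\<^esub> h) ` A) \<longleftrightarrow>
        x \<in> sym_diff (rep k ` rep g ` A) (rep k ` rep h ` A)"
      using AE_img_mult[OF k g A] AE_img_mult[OF k h A] by eventually_elim simp
  qed (intro sets.Un sets.Diff img_sets k Aut.m_closed g h A)+
  also have "sym_diff (rep k ` rep g ` A) (rep k ` rep h ` A) = rep k ` sym_diff (rep g ` A) (rep h ` A)"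
    unfolding image_Un using sub
    by (intro arg_cong2[where f="(\<union>)"] inj_on_image_set_diff[OF inj, symmetric]) auto
  also have "measure M \<dots> = img_dist A g h"
    unfolding img_dist_def using s by (intro img_measure k) auto
  finally show ?thesis .
qed

text \<open>Separability passes from the measure algebra to the orbit of \<open>A\<close>: for each
  \<open>K\<close> of a countable dense family and each \<open>n\<close>, one group element moving
  \<open>A\<close> within \<open>1 / Suc n\<close> of \<open>K\<close> is selected when there is
  one.\<close>

lemma countable_dense_orbit:
  assumes A: "A \<in> sets M"
  shows "\<exists>D. countable D \<and> D \<subseteq> G \<and> (\<forall>g\<in>G. \<forall>e>0. \<exists>a\<in>D. img_dist A a g < e)"
proof -
  obtain \<E> where "countable \<E>" "\<E> \<subseteq> Pow (space M)" "sets M = sigma_sets (space M) \<E>"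
    using standard_borel_countably_generated[OF borel] by blast
  then obtain \<K> where \<K>: "countable \<K>" "\<K> \<subseteq> sets M"
    "\<forall>A\<in>sets M. \<forall>e>0. \<exists>K\<in>\<K>. measure M (sym_diff A K) < e"
    using countable_dense_algebra by metis
  define P where "P K n g \<longleftrightarrow> g \<in> G \<and> measure M (sym_diff (rep g ` A) K) < 1 / real (Suc n)" for K n g
  \<comment> \<open>Intersecting with \<open>G\<close> discards the values of \<open>SOME\<close> at
    pairs without a witness that fall outside \<open>G\<close>.\<close>
  define D where "D = (\<lambda>(K, n). SOME g. P K n g) ` (\<K> \<times> UNIV) \<inter> G"
  have "countable D" unfolding D_def using \<K>(1)
    by (intro countable_Int1 countable_image countable_SIGMA) auto
  moreover have "\<exists>a\<in>D. img_dist A a g < e" if g: "g \<in> G" and e: "0 < e" for g e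
  proof -
    obtain n where n: "1 / real (Suc n) < e / 2"
      using reals_Archimedean[of "e / 2"] e by (auto simp: inverse_eq_divide)
    have gA: "rep g ` A \<in> sets M" using img_sets g A by blast
    obtain K where K: "K \<in> \<K>" "measure M (sym_diff (rep g ` A) K) < 1 / real (Suc n)"
      by (rule bexE[OF \<K>(3)[rule_format, OF gA, of "1 / real (Suc n)"]]) simp
    define a where "a = (SOME g. P K n g)"
    have a: "P K n a" unfolding a_def by (rule someI[of _ g]) (use g K in \<open>simp add: P_def\<close>)
    then have "a \<in> G" by (simp add: P_def)
    moreover have "a \<in> (\<lambda>(K, n). SOME g. P K n g) ` (\<K> \<times> UNIV)"
      using K(1) unfolding a_def by (intro image_eqI[of _ _ "(K, n)"]) simp_all
    ultimately have aD: "a \<in> D" by (simp add: D_def)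
    have aA: "rep a ` A \<in> sets M" using img_sets a A by (auto simp: P_def)
    have "img_dist A a g \<le> measure M (sym_diff (rep a ` A) K) + measure M (sym_diff K (rep g ` A))"
      unfolding img_dist_def using aA gA K(1) \<K>(2) by (intro measure_sym_diff_triangle) auto
    also have "\<dots> < e" using a K(2) n by (simp add: P_def Un_commute)
    finally show ?thesis using aD by blast
  qed
  ultimately show ?thesis unfolding D_def by blast
qed

section \<open>Non-commuting elements with prescribed support\<close>

lemma exists_moving:
  assumes B: "B \<in> sets M" "0 < measure M B"
  shows "\<exists>h\<in>G. \<exists>C\<in>sets M. C \<subseteq> B \<and> 0 < measure M C \<and> supported_in M B h \<and>
    (AE x in M. x \<in> C \<longrightarrow> rep h x \<notin> C)"
proof -
  \<comment> \<open>Non-atomicity splits \<open>B\<close> into two pieces of positive measure.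
    Ergodicity yields some \<open>g\<close> carrying a non-null part \<open>C g\<close> of
    \<open>B1\<close> into \<open>B2\<close>, and swapping this part with its image gives the
    desired involution.\<close>
  have "nonatomic M" using std by (simp add: standard_prob_space_def)
  then obtain B1 where B1: "B1 \<in> sets M" "B1 \<subseteq> B" "0 < measure M B1" "measure M B1 < measure M B"
    using B unfolding nonatomic_def by blast
  define B2 where "B2 = B - B1"
  have B2: "B2 \<in> sets M" "B2 \<subseteq> B" "B1 \<inter> B2 = {}" using B B1 by (auto simp: B2_def)
  have B2pos: "0 < measure M B2"
    using finite_measure_Diff[OF B(1) B1(1,2)] B1(4) by (simp add: B2_def)
  define C where "C g = {x \<in> space M. x \<in> B1 \<and> rep g x \<in> B2}" for g
  have Csets: "C g \<in> sets M" if "g \<in> G" for g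
  proof -
    have [measurable]: "rep g \<in> measurable M M" "B1 \<in> sets M" "B2 \<in> sets M"
      using G_rep_measurable[OF that] B1 B2 by auto
    show ?thesis unfolding C_def by measurable
  qed
  have "\<exists>g\<in>G. 0 < measure M (C g)"
  proof (rule ccontr)
    assume "\<not> ?thesis"
    then have C0: "measure M (C g) = 0" if "g \<in> G" for g
      using that by (simp add: measure_le_0_iff not_less)
    obtain D where D: "countable D" "D \<subseteq> G" "\<forall>g\<in>G. \<forall>e>0. \<exists>a\<in>D. img_dist B1 a g < e"
      using countable_dense_orbit[OF B1(1)] by (elim exE conjE)
    \<comment> \<open>This countable union stands in for the union of all translates of
      \<open>B1\<close>: by density of \<open>D\<close> it contains each of them up to a null
      set.\<close>
    define W where "W = (\<Union>a\<in>D. rep a ` B1)"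
    have iB: "rep g ` B1 \<in> sets M" if "g \<in> G" for g using img_sets that B1 by blast
    have W: "W \<in> sets M" unfolding W_def using D(1,2) iB by (intro sets.countable_UN') auto
    have orbit: "AE x in M. x \<in> rep g ` B1 \<longrightarrow> x \<in> W" if g: "g \<in> G" for g
    proof -
      have "measure M (rep g ` B1 - W) \<le> e" if e: "0 < e" for e
      proof -
        obtain a where a: "a \<in> D" "img_dist B1 a g < e" using D(3) g e by blast
        have "measure M (rep g ` B1 - W) \<le> img_dist B1 a g"
          unfolding img_dist_def using a(1) D(2) iB g
          by (intro finite_measure_mono) (auto simp: W_def)
        then show ?thesis using a(2) by simp
      qed
      then have "measure M (rep g ` B1 - W) \<le> 0" by (rule field_le_epsilon) simp
      then have "rep g ` B1 - W \<in> null_sets M"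
        using iB[OF g] W by (auto simp: null_sets_def emeasure_eq_measure measure_le_0_iff)
      then have "AE x in M. x \<notin> rep g ` B1 - W" by (rule AE_not_in)
      then show ?thesis by eventually_elim simp
    qed
    have "measure M (sym_diff W (rep k ` W)) = 0" if k: "k \<in> G" for k
    proof -
      have kW: "rep k ` W \<in> sets M" "measure M (rep k ` W) = measure M W"
        using img k W by blast+
      have "AE x in M. x \<in> rep k ` rep a ` B1 \<longrightarrow> x \<in> W" if a: "a \<in> D" for a
      proof -
        have "a \<in> G" using a D(2) by blast
        then have "AE x in M. x \<in> rep (k \<otimes>\<^bsub>Aut M\<^esub> a) ` B1 \<longleftrightarrow> x \<in> rep k ` rep a ` B1"
          "AE x in M. x \<in> rep (k \<otimes>\<^bsub>Aut M\<^esub> a) ` B1 \<longrightarrow> x \<in> W"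
          using AE_img_mult k B1(1) orbit by blast+
        then show ?thesis by eventually_elim simp
      qed
      then have "AE x in M. \<forall>a\<in>D. x \<in> rep k ` rep a ` B1 \<longrightarrow> x \<in> W"
        by (subst AE_ball_countable[OF D(1)]) blast
      then have sub: "AE x in M. x \<in> rep k ` W \<longrightarrow> x \<in> W"
      proof eventually_elim
        case (elim x)
        then show ?case unfolding W_def image_UN by blast
      qed
      \<comment> \<open>The image of \<open>W\<close> lies in \<open>W\<close> almost everywhere and
        has the same measure, so the two differ by a null set.\<close>
      have "measure M (rep k ` W - W) = measure M {}"
        using sub kW W by (intro finite_measure_eq_AE) auto
      moreover have "measure M (W \<inter> rep k ` W) = measure M (rep k ` W)"
        using sub kW W by (intro finite_measure_eq_AE) auto
      then have "measure M (W - rep k ` W) = 0"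
        using finite_measure_Diff'[OF W kW(1)] kW(2) by simp
      moreover have "measure M (sym_diff W (rep k ` W)) = measure M (W - rep k ` W) + measure M (rep k ` W - W)"
        using W kW by (intro finite_measure_Union) auto
      ultimately show ?thesis by simp
    qed
    then have "measure M W = 0 \<or> measure M W = 1"
      using erg W unfolding ergodic_group_def by blast
    moreover have "AE x in M. x \<in> B1 \<longrightarrow> x \<in> W"
    proof -
      have "AE x in M. x \<in> rep \<one>\<^bsub>Aut M\<^esub> ` B1 \<longrightarrow> x \<in> W" using orbit by blast
      moreover have "AE x in M. x \<in> rep \<one>\<^bsub>Aut M\<^esub> ` B1 \<longleftrightarrow> x \<in> id ` B1"
        using AE_image_aut_class[OF id_mp_bij B1(1)] by (simp add: Aut_def)
      ultimately show ?thesis by eventually_elim simp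
    qed
    then have "measure M B1 \<le> measure M W"
      using W by (intro finite_measure_mono_AE) auto
    ultimately have "measure M W = 1" using B1(3) by linarith
    then have "AE x in M. x \<in> W" using W by (simp add: prob_eq_1)
    moreover have "AE x in M. \<forall>a\<in>D. x \<notin> rep a ` B1 \<inter> B2"
    proof (subst AE_ball_countable[OF D(1)], rule ballI)
      fix a assume "a \<in> D"
      then have a: "a \<in> G" using D(2) by blast
      \<comment> \<open>What \<open>a\<close> carries from \<open>B1\<close> into \<open>B2\<close>
        is the image of \<open>C a\<close>, null by assumption. As \<open>W\<close> is conull,
        \<open>B2\<close> would be null.\<close>
      have "rep a ` B1 \<inter> B2 = rep a ` C a"
        using sets.sets_into_space[OF B1(1)] by (auto simp: C_def)
      moreover have "measure M (rep a ` C a) = 0" "rep a ` C a \<in> sets M"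
        using img[OF G_carrier[OF a] Csets[OF a]] C0[OF a] by auto
      ultimately have "rep a ` B1 \<inter> B2 \<in> null_sets M"
        by (auto simp: null_sets_def emeasure_eq_measure)
      then show "AE x in M. x \<notin> rep a ` B1 \<inter> B2" by (rule AE_not_in)
    qed
    ultimately have "AE x in M. x \<notin> B2" by eventually_elim (auto simp: W_def)
    then have "measure M B2 = measure M {}"
      using B2 by (intro finite_measure_eq_AE) auto
    with B2pos show False by simp
  qed
  then obtain g where g: "g \<in> G" "0 < measure M (C g)" by blast
  note Cg = Csets[OF g(1)]
  have "AE x in M. x \<in> C g \<longrightarrow> rep g x \<notin> C g"
    using B2(3) by (intro AE_I2) (auto simp: C_def)
  then obtain h where h: "h \<in> G" "AE x in M. x \<in> C g \<longrightarrow> rep h x = rep g x"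
    "supported_in M (C g \<union> {x. rep (inv\<^bsub>Aut M\<^esub> g) x \<in> C g}) h"
    using exists_swap[OF g(1) Cg] by blast
  have "AE x in M. x \<in> C g \<union> {x. rep (inv\<^bsub>Aut M\<^esub> g) x \<in> C g} \<longrightarrow> x \<in> B"
    using rep_inv_right[OF G_carrier[OF g(1)]]
  proof eventually_elim
    case (elim x)
    then show ?case using B1(2) B2(2) by (auto simp: C_def)
  qed
  then have "supported_in M B h" by (rule supported_in_mono[OF h(3)])
  moreover have "AE x in M. x \<in> C g \<longrightarrow> rep h x \<notin> C g"
    using h(2)
  proof eventually_elim
    case (elim x)
    then show ?case using B2(3) by (auto simp: C_def)
  qed
  ultimately show ?thesis using h(1) Cg g(2) B1(2) by (intro bexI[of _ h] bexI[of _ "C g"]) (auto simp: C_def)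
qed

text \<open>Let \<open>h\<close> move \<open>C\<close> off itself and let \<open>k\<close>,
  supported in \<open>C\<close>, move \<open>C'\<close> off itself. For \<open>x\<close> in
  \<open>C'\<close> the point \<open>h x\<close> is outside \<open>C\<close>, so \<open>k\<close>
  fixes it; if \<open>h\<close> and \<open>k\<close> commuted, \<open>h (k x) = h x\<close> and
  hence \<open>k x = x\<close>.\<close>

lemma exists_noncommuting:
  assumes B: "B \<in> sets M" "0 < measure M B"
  shows "\<exists>h\<in>G. \<exists>k\<in>G. supported_in M B h \<and> supported_in M B k \<and>
    h \<otimes>\<^bsub>Aut M\<^esub> k \<noteq> k \<otimes>\<^bsub>Aut M\<^esub> h"
proof -
  obtain h C where h: "h \<in> G" "C \<in> sets M" "C \<subseteq> B" "0 < measure M C" "supported_in M B h"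
    "AE x in M. x \<in> C \<longrightarrow> rep h x \<notin> C"
    using exists_moving[OF B] by blast
  obtain k C' where k: "k \<in> G" "C' \<in> sets M" "C' \<subseteq> C" "0 < measure M C'" "supported_in M C k"
    "AE x in M. x \<in> C' \<longrightarrow> rep k x \<notin> C'"
    using exists_moving[OF h(2,4)] by blast
  note hc = G_carrier[OF h(1)] and kc = G_carrier[OF k(1)]
  have "h \<otimes>\<^bsub>Aut M\<^esub> k \<noteq> k \<otimes>\<^bsub>Aut M\<^esub> h"
  proof
    assume eq: "h \<otimes>\<^bsub>Aut M\<^esub> k = k \<otimes>\<^bsub>Aut M\<^esub> h"
    have "AE x in M. x \<notin> C'"
      using rep_mult[OF hc kc] rep_mult[OF kc hc] h(6) k(6)
        AE_rep[OF hc k(5)[unfolded supported_in_def]] AE_space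
    proof eventually_elim
      case (elim x)
      show ?case
      proof
        assume x: "x \<in> C'"
        then have "rep k (rep h x) = rep h x" using elim k(3) by auto
        then have "rep h (rep k x) = rep h x" using elim eq by simp
        then have "rep k x = x"
          using rep_inj[OF hc] elim measurable_space[OF rep_measurable[OF kc]] by blast
        then show False using elim x by simp
      qed
    qed
    then have "measure M C' = measure M {}"
      using k(2) by (intro finite_measure_eq_AE) auto
    with k(4) show False by simp
  qed
  moreover have "supported_in M B k"
    using supported_in_mono[OF k(5)] h(3) by auto
  ultimately show ?thesis using h k by blast
qed

text \<open>Turns a measure-theoretic inclusion into group equations, to which any group topology
  applies. If \<open>g\<close> maps \<open>A\<close> into \<open>C\<close>, then
  \<open>g h g\<inverse>\<close> is supported in \<open>C\<close> and commutes with
  \<open>k\<close>. If not, non-commuting elements supported in the image of \<open>A\<close>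
  outside \<open>C\<close> violate the equations.\<close>

lemma maps_into_iff_commute:
  assumes g: "g \<in> G" and A: "A \<in> sets M" and C: "C \<in> sets M"
  shows "(AE x in M. x \<in> A \<longrightarrow> rep g x \<in> C) \<longleftrightarrow>
    (\<forall>h\<in>G. \<forall>k\<in>G. supported_in M A h \<longrightarrow> supported_in M (- C) k \<longrightarrow>
      g \<otimes>\<^bsub>Aut M\<^esub> h \<otimes>\<^bsub>Aut M\<^esub> inv\<^bsub>Aut M\<^esub> g \<otimes>\<^bsub>Aut M\<^esub> k =
      k \<otimes>\<^bsub>Aut M\<^esub> (g \<otimes>\<^bsub>Aut M\<^esub> h \<otimes>\<^bsub>Aut M\<^esub> inv\<^bsub>Aut M\<^esub> g))" (is "?L \<longleftrightarrow> ?R")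
proof
  assume L: ?L
  show ?R
  proof (intro ballI impI)
    fix h k assume h: "h \<in> G" "supported_in M A h" and k: "k \<in> G" "supported_in M (- C) k"
    have "supported_in M C (g \<otimes>\<^bsub>Aut M\<^esub> h \<otimes>\<^bsub>Aut M\<^esub> inv\<^bsub>Aut M\<^esub> g)"
      using supported_in_conj[OF G_carrier[OF g] G_carrier[OF h(1)] h(2) L] .
    then show "g \<otimes>\<^bsub>Aut M\<^esub> h \<otimes>\<^bsub>Aut M\<^esub> inv\<^bsub>Aut M\<^esub> g \<otimes>\<^bsub>Aut M\<^esub> k =
      k \<otimes>\<^bsub>Aut M\<^esub> (g \<otimes>\<^bsub>Aut M\<^esub> h \<otimes>\<^bsub>Aut M\<^esub> inv\<^bsub>Aut M\<^esub> g)"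
      using g h(1) k by (intro supported_in_commute[of _ M]) auto
  qed
next
  assume R: ?R
  let ?i = "inv\<^bsub>Aut M\<^esub> g"
  have gc: "g \<in> carrier (Aut M)" and i: "?i \<in> G" and ic: "?i \<in> carrier (Aut M)" using g by auto
  have [measurable]: "rep g \<in> measurable M M" "rep ?i \<in> measurable M M" "A \<in> sets M" "C \<in> sets M"
    using G_rep_measurable g i A C by auto
  \<comment> \<open>Up to a null set, the image of \<open>A\<close> under \<open>g\<close> without
    \<open>C\<close>.\<close>
  define B where "B = {x \<in> space M. x \<notin> C \<and> rep ?i x \<in> A}"
  have B: "B \<in> sets M" unfolding B_def by measurable
  have "measure M B = 0"
  proof (rule ccontr)
    assume "measure M B \<noteq> 0"
    then have "0 < measure M B" by (simp add: zero_less_measure_iff)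
    then obtain f k where f: "f \<in> G" "supported_in M B f" and k: "k \<in> G" "supported_in M B k"
      and ne: "f \<otimes>\<^bsub>Aut M\<^esub> k \<noteq> k \<otimes>\<^bsub>Aut M\<^esub> f"
      using exists_noncommuting[OF B] by blast
    \<comment> \<open>Chosen so that conjugating \<open>h\<close> by \<open>g\<close> gives back
      \<open>f\<close>; its support lies in \<open>A\<close> because \<open>f\<close> is supported
      in the image of \<open>A\<close>.\<close>
    define h where "h = ?i \<otimes>\<^bsub>Aut M\<^esub> f \<otimes>\<^bsub>Aut M\<^esub> g"
    have fc: "f \<in> carrier (Aut M)" using f by auto
    have h: "h \<in> G" unfolding h_def using g i f by auto
    have "supported_in M A (?i \<otimes>\<^bsub>Aut M\<^esub> f \<otimes>\<^bsub>Aut M\<^esub> inv\<^bsub>Aut M\<^esub> ?i)"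
      using f(2) by (intro supported_in_conj[OF ic fc]) (auto simp: B_def)
    then have hA: "supported_in M A h" using gc by (simp add: h_def)
    have kC: "supported_in M (- C) k" using supported_in_mono[OF k(2)] by (auto simp: B_def)
    have "g \<otimes>\<^bsub>Aut M\<^esub> h \<otimes>\<^bsub>Aut M\<^esub> ?i = f"
    proof -
      have "g \<otimes>\<^bsub>Aut M\<^esub> h = f \<otimes>\<^bsub>Aut M\<^esub> g"
        using gc ic fc by (simp add: h_def Aut.m_assoc[symmetric])
      then show ?thesis using gc fc by (simp add: Aut.m_assoc)
    qed
    then show False using R h k(1) hA kC ne by metis
  qed
  then have "B \<in> null_sets M" using B by (auto simp: null_sets_def emeasure_eq_measure)
  then have "AE x in M. x \<notin> B" by (rule AE_not_in)
  from AE_rep[OF gc this] rep_inv_left[OF gc] AE_space show ?L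
  proof eventually_elim
    case (elim x)
    then show ?case using measurable_space[OF rep_measurable[OF gc]] by (auto simp: B_def)
  qed
qed

section \<open>Completely metrizable group topologies on the full group refine the weak
  topology\<close>

abbreviation GG :: "('a \<Rightarrow> 'a) set monoid" where
  "GG \<equiv> (Aut M)\<lparr>carrier := G\<rparr>"

lemma group_GG: "group GG"
  using subgroup.subgroup_is_group[OF subgroup_G group_Aut] .

text \<open>The inclusion amounts to equalities between two continuous group words in the variable
  \<open>g\<close>, and in a Hausdorff space such equalities pass to limits.\<close>

lemma limit_maps_into:
  assumes \<tau>: "group_topology GG \<tau>" "Hausdorff_space \<tau>"
    and lim: "limitin \<tau> s g sequentially" and s: "\<And>n. s n \<in> G"
    and A: "A \<in> sets M" and C: "C \<in> sets M"
    and into: "\<And>n. AE x in M. x \<in> A \<longrightarrow> rep (s n) x \<in> C"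
  shows "AE x in M. x \<in> A \<longrightarrow> rep g x \<in> C"
proof -
  have top: "topspace \<tau> = G" using \<tau>(1) by (simp add: group_topology_def)
  have g: "g \<in> G" using lim limitin_topspace top by metis
  have "g \<otimes>\<^bsub>Aut M\<^esub> h \<otimes>\<^bsub>Aut M\<^esub> inv\<^bsub>Aut M\<^esub> g \<otimes>\<^bsub>Aut M\<^esub> k =
      k \<otimes>\<^bsub>Aut M\<^esub> (g \<otimes>\<^bsub>Aut M\<^esub> h \<otimes>\<^bsub>Aut M\<^esub> inv\<^bsub>Aut M\<^esub> g)"
    if h: "h \<in> G" "supported_in M A h" and k: "k \<in> G" "supported_in M (- C) k" for h k
  proof -
    define \<phi> where "\<phi> x = x \<otimes>\<^bsub>GG\<^esub> h \<otimes>\<^bsub>GG\<^esub> inv\<^bsub>GG\<^esub> x \<otimes>\<^bsub>GG\<^esub> k" for x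
    define \<psi> where "\<psi> x = k \<otimes>\<^bsub>GG\<^esub> (x \<otimes>\<^bsub>GG\<^esub> h \<otimes>\<^bsub>GG\<^esub> inv\<^bsub>GG\<^esub> x)" for x
    \<comment> \<open>Continuity is available for the operations of \<open>GG\<close>, the
      commutation criterion for those of \<open>Aut M\<close>; inverses agree because
      \<open>G\<close> is a subgroup.\<close>
    have eq: "\<phi> x = x \<otimes>\<^bsub>Aut M\<^esub> h \<otimes>\<^bsub>Aut M\<^esub> inv\<^bsub>Aut M\<^esub> x \<otimes>\<^bsub>Aut M\<^esub> k"
      "\<psi> x = k \<otimes>\<^bsub>Aut M\<^esub> (x \<otimes>\<^bsub>Aut M\<^esub> h \<otimes>\<^bsub>Aut M\<^esub> inv\<^bsub>Aut M\<^esub> x)" if "x \<in> G" for x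
      using Aut.m_inv_consistent[OF subgroup_G that] by (simp_all add: \<phi>_def \<psi>_def)
    have cont: "continuous_map \<tau> \<tau> \<phi>" "continuous_map \<tau> \<tau> \<psi>"
      unfolding \<phi>_def \<psi>_def using h(1) k(1) continuous_map_id[of \<tau>]
      by (intro group_topology_mult[OF \<tau>(1)] group_topology_inv[OF \<tau>(1)]
          group_topology_const[OF \<tau>(1)]; simp add: id_def)+
    have "\<phi> \<circ> s = \<psi> \<circ> s"
    proof
      fix n
      have "\<phi> (s n) = \<psi> (s n)"
        unfolding eq[OF s]
        by (rule maps_into_iff_commute[THEN iffD1, rule_format, OF s A C into h(1) k(1) h(2) k(2)])
      then show "(\<phi> \<circ> s) n = (\<psi> \<circ> s) n" by simp
    qed
    then have "\<phi> g = \<psi> g"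
      using continuous_map_limit[OF cont(1) lim] continuous_map_limit[OF cont(2) lim]
        limitin_Hausdorff_unique[of \<tau> "\<phi> \<circ> s"] \<tau>(2) by auto
    then show ?thesis using eq[OF g] by simp
  qed
  then show ?thesis using maps_into_iff_commute[OF g A C] by blast
qed

text \<open>The union \<open>C\<close> of all images of \<open>A\<close> under the
  \<open>s n\<close> has measure at most \<open>2 * e\<close> more than \<open>A\<close>. Every
  \<open>s n\<close> maps \<open>A\<close> into \<open>C\<close>, so the limit \<open>g\<close> does
  as well. The images under \<open>s 0\<close> and \<open>g\<close> both have the measure of
  \<open>A\<close> and each misses at most \<open>2 * e\<close> of \<open>C\<close>, which gives
  \<open>4 * e\<close>.\<close>

lemma img_dist_limit_le:
  assumes \<tau>: "group_topology GG \<tau>" "Hausdorff_space \<tau>"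
    and lim: "limitin \<tau> s g sequentially" and s: "\<And>n. s n \<in> G"
    and A: "A \<in> sets M" and e: "0 < e"
    and fast: "\<And>n. img_dist A (s n) (s (Suc n)) < e / 2 ^ n"
  shows "img_dist A (s 0) g \<le> 4 * e"
proof -
  have "topspace \<tau> = G" using \<tau>(1) by (simp add: group_topology_def)
  then have g: "g \<in> G" using lim limitin_topspace by metis
  define E where "E n = rep (s n) ` A" for n
  have E: "E n \<in> sets M" "measure M (E n) = measure M A" for n
    using img s A unfolding E_def by blast+
  define C where "C = (\<Union>n. E n)"
  have C: "C \<in> sets M" unfolding C_def using E by blast
  \<comment> \<open>Adjoining \<open>E (Suc n)\<close> adds less than \<open>e / 2 ^ n\<close>,
    since \<open>E n\<close> is already included.\<close>
  have part: "measure M (\<Union>i\<le>n. E i) \<le> measure M A + 2 * e - 2 * e / 2 ^ n" for n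
  proof (induction n)
    case (Suc n)
    have u: "(\<Union>i\<le>n. E i) \<in> sets M" using E by blast
    have "measure M (\<Union>i\<le>Suc n. E i) = measure M ((\<Union>i\<le>n. E i) \<union> (E (Suc n) - E n))"
      by (intro arg_cong[where f="measure M"]) (auto simp: atMost_Suc)
    also have "\<dots> \<le> measure M (\<Union>i\<le>n. E i) + measure M (E (Suc n) - E n)"
      using u E by (intro measure_Un_le) auto
    also have "measure M (E (Suc n) - E n) \<le> img_dist A (s n) (s (Suc n))"
      unfolding img_dist_def E_def[symmetric] using E by (intro finite_measure_mono) auto
    finally have "measure M (\<Union>i\<le>Suc n. E i) \<le> measure M A + 2 * e - 2 * e / 2 ^ n + e / 2 ^ n"
      using Suc fast[of n] by linarith
    also have "\<dots> = measure M A + 2 * e - 2 * e / 2 ^ Suc n" by (simp add: field_simps)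
    finally show ?case .
  qed (simp add: E)
  have "incseq (\<lambda>n. \<Union>i\<le>n. E i)" by (intro incseq_SucI UN_mono) auto
  then have "(\<lambda>n. measure M (\<Union>i\<le>n. E i)) \<longlonglongrightarrow> measure M (\<Union>n. \<Union>i\<le>n. E i)"
    using E by (intro finite_Lim_measure_incseq) blast+
  moreover have "(\<Union>n. \<Union>i\<le>n. E i) = C" unfolding C_def by auto
  ultimately have "(\<lambda>n. measure M (\<Union>i\<le>n. E i)) \<longlonglongrightarrow> measure M C" by simp
  moreover have "measure M (\<Union>i\<le>n. E i) \<le> measure M A + 2 * e" for n
  proof -
    have "0 \<le> 2 * e / 2 ^ n" using e by simp
    then show ?thesis using part[of n] by linarith
  qed
  ultimately have mC: "measure M C \<le> measure M A + 2 * e"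
    by (intro LIMSEQ_le_const2) auto
  have into: "AE x in M. x \<in> A \<longrightarrow> rep g x \<in> C"
    by (rule limit_maps_into[OF \<tau> lim s A C]) (auto simp: C_def E_def)
  \<comment> \<open>The points where the inclusion fails are null, and so is their image; this moves
    the statement from points of \<open>A\<close> to points of its image.\<close>
  define N where "N = {x \<in> space M. x \<in> A \<and> rep g x \<notin> C}"
  have [measurable]: "rep g \<in> measurable M M" using G_rep_measurable[OF g] .
  have N: "N \<in> sets M" unfolding N_def using A C by measurable
  have "measure M N = measure M {}"
    using into N by (intro finite_measure_eq_AE) (auto simp: N_def)
  then have "rep g ` N \<in> null_sets M"
    using img[OF G_carrier[OF g] N] by (auto simp: null_sets_def emeasure_eq_measure)
  then have "AE x in M. x \<notin> rep g ` N" by (rule AE_not_in)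
  then have gC: "AE x in M. x \<in> rep g ` A \<longrightarrow> x \<in> C"
  proof eventually_elim
    case (elim x)
    then show ?case using sets.sets_into_space[OF A] by (auto simp: N_def)
  qed
  have gA: "rep g ` A \<in> sets M" "measure M (rep g ` A) = measure M A" using img g A by blast+
  have "measure M (C \<inter> rep g ` A) = measure M (rep g ` A)"
    using gC C gA by (intro finite_measure_eq_AE) auto
  then have "measure M (C - rep g ` A) = measure M C - measure M A"
    using finite_measure_Diff'[OF C gA(1)] gA(2) by simp
  moreover have "measure M (C - E 0) = measure M C - measure M A"
    using finite_measure_Diff[OF C E(1), of 0] E(2) by (auto simp: C_def)
  moreover have "img_dist A (s 0) g \<le> measure M ((C - E 0) \<union> (C - rep g ` A))"
    unfolding img_dist_def E_def[symmetric]
    using gC C gA E by (intro finite_measure_mono_AE) (auto simp: C_def)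
  moreover have "\<dots> \<le> measure M (C - E 0) + measure M (C - rep g ` A)"
    using C gA E by (intro measure_Un_le) auto
  ultimately show ?thesis using mC by linarith
qed

text \<open>The closed graph principle for \<open>img_dist A\<close>: the limit condition is
  \<open>img_dist_limit_le\<close>, and the countable cover comes from left invariance and a
  countable dense part of the orbit of \<open>A\<close>.\<close>

lemma img_dist_continuous:
  assumes \<tau>: "group_topology GG \<tau>" "completely_metrizable_space \<tau>"
    and A: "A \<in> sets M" and g: "g \<in> G" and e: "0 < e"
  shows "\<exists>W. openin \<tau> W \<and> g \<in> W \<and> (\<forall>h\<in>W. img_dist A g h < e)"
proof (rule closed_graph_pseudometric[OF group_GG \<tau>, where \<rho>="img_dist A"])
  have H: "Hausdorff_space \<tau>"
    using \<tau>(2) completely_metrizable_imp_metrizable_space metrizable_imp_Hausdorff_space by blast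
  show "img_dist A x y = img_dist A y x" for x y by (rule img_dist_sym)
  show "img_dist A x z \<le> img_dist A x y + img_dist A y z"
    if "x \<in> carrier GG" "y \<in> carrier GG" "z \<in> carrier GG" for x y z
    using that A by (intro img_dist_triangle) auto
  show "img_dist A (s 0) x \<le> 4 * e"
    if "limitin \<tau> s x sequentially" "\<And>n. s n \<in> carrier GG" "0 < e"
      "\<And>n. img_dist A (s n) (s (Suc n)) < e / 2 ^ n" for s x e
    using img_dist_limit_le[OF \<tau>(1) H that(1) _ A that(3,4)] that(2) by simp
next
  fix x and e :: real assume x: "x \<in> carrier GG" and e: "0 < e"
  have x: "x \<in> G" using x by simp
  \<comment> \<open>Half of \<open>e\<close>, because by left invariance the distance from
    \<open>x\<close> to \<open>x u\<inverse> v\<close> equals that from \<open>u\<close> to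
    \<open>v\<close>, which is estimated through the identity.\<close>
  let ?V = "{u \<in> G. img_dist A \<one>\<^bsub>Aut M\<^esub> u < e / 2}"
  obtain D where D: "countable D" "D \<subseteq> G" "\<forall>g\<in>G. \<forall>e>0. \<exists>a\<in>D. img_dist A a g < e"
    using countable_dense_orbit[OF A] by (elim exE conjE)
  have shift: "img_dist A \<one>\<^bsub>Aut M\<^esub> (inv\<^bsub>Aut M\<^esub> a \<otimes>\<^bsub>Aut M\<^esub> g) = img_dist A a g"
    if "a \<in> G" "g \<in> G" for a g
    using img_dist_mult_left[OF A, of a g "inv\<^bsub>Aut M\<^esub> a"] that by (simp add: G_carrier)
  have "G \<subseteq> (\<Union>a\<in>D. (\<lambda>v. a \<otimes>\<^bsub>Aut M\<^esub> v) ` ?V)"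
  proof
    fix g assume g: "g \<in> G"
    have "0 < e / 2" using e by simp
    then obtain a where a: "a \<in> D" "img_dist A a g < e / 2" using D(3) g by blast
    have aG: "a \<in> G" using a D by blast
    have "g = a \<otimes>\<^bsub>Aut M\<^esub> (inv\<^bsub>Aut M\<^esub> a \<otimes>\<^bsub>Aut M\<^esub> g)"
      using aG g by (simp add: Aut.m_assoc[symmetric] G_carrier)
    moreover have "inv\<^bsub>Aut M\<^esub> a \<otimes>\<^bsub>Aut M\<^esub> g \<in> ?V"
      using shift[OF aG g] a aG g by auto
    ultimately show "g \<in> (\<Union>a\<in>D. (\<lambda>v. a \<otimes>\<^bsub>Aut M\<^esub> v) ` ?V)" using a(1) by blast
  qed
  moreover have "img_dist A x (x \<otimes>\<^bsub>Aut M\<^esub> (inv\<^bsub>Aut M\<^esub> u \<otimes>\<^bsub>Aut M\<^esub> v)) < e"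
    if u: "u \<in> ?V" and v: "v \<in> ?V" for u v
  proof -
    have uv: "u \<in> G" "v \<in> G" using u v by auto
    have "img_dist A x (x \<otimes>\<^bsub>Aut M\<^esub> (inv\<^bsub>Aut M\<^esub> u \<otimes>\<^bsub>Aut M\<^esub> v)) =
        img_dist A \<one>\<^bsub>Aut M\<^esub> (inv\<^bsub>Aut M\<^esub> u \<otimes>\<^bsub>Aut M\<^esub> v)"
      using img_dist_mult_left[OF A, of "\<one>\<^bsub>Aut M\<^esub>" "inv\<^bsub>Aut M\<^esub> u \<otimes>\<^bsub>Aut M\<^esub> v" x] x uv
      by (simp add: G_carrier)
    also have "\<dots> = img_dist A u v" by (rule shift[OF uv])
    also have "\<dots> \<le> img_dist A u \<one>\<^bsub>Aut M\<^esub> + img_dist A \<one>\<^bsub>Aut M\<^esub> v"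
      using uv A by (intro img_dist_triangle) auto
    also have "\<dots> < e" using u v by (simp add: img_dist_sym[of A u])
    finally show ?thesis .
  qed
  ultimately show "\<exists>V D. V \<subseteq> carrier GG \<and> countable D \<and> D \<subseteq> carrier GG \<and>
      carrier GG \<subseteq> (\<Union>a\<in>D. (\<lambda>v. a \<otimes>\<^bsub>GG\<^esub> v) ` V) \<and>
      (\<forall>u\<in>V. \<forall>v\<in>V. img_dist A x (x \<otimes>\<^bsub>GG\<^esub> (inv\<^bsub>GG\<^esub> u \<otimes>\<^bsub>GG\<^esub> v)) < e)"
    using D(1,2) Aut.m_inv_consistent[OF subgroup_G]
    by (intro exI[of _ ?V] exI[of _ D]) simp
qed (use g e in auto)

lemma weak_topology_coarser:
  assumes \<tau>: "group_topology GG \<tau>" "completely_metrizable_space \<tau>"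
    and U: "openin (subtopology (weak_topology M) G) U"
  shows "openin \<tau> U"
proof -
  have top: "topspace \<tau> = G" using \<tau>(1) by (simp add: group_topology_def)
  have "continuous_map \<tau> (weak_topology M) (\<lambda>g. g)"
    unfolding weak_topology_def continuous_on_generated_topo_iff
  proof (intro conjI allI impI)
    fix B assume "B \<in> {{h \<in> carrier (Aut M). measure M (sym_diff (rep h ` A) (rep g ` A)) < e} |g A e.
        g \<in> carrier (Aut M) \<and> A \<in> sets M \<and> 0 < e}"
    then obtain g A e where g: "g \<in> carrier (Aut M)" and A: "A \<in> sets M"
      and B: "B = {h \<in> carrier (Aut M). img_dist A h g < e}"
      by (auto simp: img_dist_def)
    \<comment> \<open>The centre \<open>g\<close> of the subbasic set need not belong to
      \<open>G\<close>, so neighbourhoods are taken around each point \<open>h\<close> of its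
      intersection with \<open>G\<close>.\<close>
    have "\<exists>W. openin \<tau> W \<and> h \<in> W \<and> W \<subseteq> B \<inter> G" if h: "h \<in> B \<inter> G" for h
    proof -
      have hG: "h \<in> G" and "0 < e - img_dist A h g" using h by (auto simp: B)
      then obtain W where W: "openin \<tau> W" "h \<in> W" "\<forall>k\<in>W. img_dist A h k < e - img_dist A h g"
        using img_dist_continuous[OF \<tau> A] by blast
      have WG: "W \<subseteq> G" using openin_subset[OF W(1)] top by simp
      have "k \<in> B \<inter> G" if k: "k \<in> W" for k
      proof -
        have kG: "k \<in> G" using k WG by blast
        have "img_dist A k g \<le> img_dist A k h + img_dist A h g"
          using A kG hG g by (intro img_dist_triangle) auto
        also have "\<dots> < e" using W(3) k img_dist_sym[of A k h] by auto
        finally show ?thesis using kG by (auto simp: B)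
      qed
      with W show ?thesis by blast
    qed
    then have "openin \<tau> (B \<inter> G)" by (subst openin_subopen) blast
    then show "openin \<tau> ((\<lambda>g. g) -` B \<inter> topspace \<tau>)" by (simp add: top vimage_def)
  next
    have "topspace (weak_topology M) = carrier (Aut M)" by (rule topspace_weak_topology)
    then show "(\<lambda>g. g) ` topspace \<tau> \<subseteq> \<Union>{{h \<in> carrier (Aut M). measure M (sym_diff (rep h ` A) (rep g ` A)) < e} |g A e.
        g \<in> carrier (Aut M) \<and> A \<in> sets M \<and> 0 < e}"
      unfolding weak_topology_def topology_generated_by_topspace top using G_carrier by auto
  qed
  moreover obtain T where T: "openin (weak_topology M) T" "U = T \<inter> G"
    using U by (auto simp: openin_subtopology)
  ultimately have "openin \<tau> {x \<in> topspace \<tau>. x \<in> T}"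
    by (intro openin_continuous_map_preimage)
  moreover have "{x \<in> topspace \<tau>. x \<in> T} = U" using T(2) top by auto
  ultimately show ?thesis by simp
qed

text \<open>For each set of a countable generating family, \<open>x\<close> and
  \<open>h\<inverse> (g x)\<close> are almost everywhere on the same side of it. These countably
  many conditions hold simultaneously almost everywhere, and the family separates points.\<close>

lemma img_dist_separates:
  assumes g: "g \<in> G" and h: "h \<in> G" and zero: "\<And>A. A \<in> sets M \<Longrightarrow> img_dist A g h = 0"
  shows "g = h"
proof -
  obtain \<E> where \<E>: "countable \<E>" "\<E> \<subseteq> Pow (space M)" "sets M = sigma_sets (space M) \<E>"
    using standard_borel_countably_generated[OF borel] by blast
  note gc = G_carrier[OF g] and hc = G_carrier[OF h]
  have sp: "rep g x \<in> space M" "rep h x \<in> space M" if "x \<in> space M" for x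
    using that measurable_space[OF rep_measurable[OF gc]] measurable_space[OF rep_measurable[OF hc]] by auto
  have ii: "inv\<^bsub>Aut M\<^esub> h \<in> carrier (Aut M)" using hc by simp
  let ?k = "rep (inv\<^bsub>Aut M\<^esub> h)"
  have "AE x in M. \<forall>A\<in>\<E>. x \<in> A \<longleftrightarrow> ?k (rep g x) \<in> A"
  proof (subst AE_ball_countable[OF \<E>(1)], rule ballI)
    fix A assume "A \<in> \<E>"
    then have A: "A \<in> sets M" unfolding \<E>(3) by (rule sigma_sets.Basic)
    have "sym_diff (rep g ` A) (rep h ` A) \<in> null_sets M"
      using zero[OF A] img_sets[OF gc A] img_sets[OF hc A]
      by (auto simp: null_sets_def emeasure_eq_measure img_dist_def)
    then have "AE x in M. x \<notin> sym_diff (rep g ` A) (rep h ` A)" by (rule AE_not_in)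
    from AE_rep[OF gc this] AE_rep[OF gc rep_inv_right[OF hc]] AE_space
    show "AE x in M. x \<in> A \<longleftrightarrow> ?k (rep g x) \<in> A"
    proof eventually_elim
      case (elim x)
      have "?k (rep g x) \<in> space M"
        using measurable_space[OF rep_measurable[OF ii]] sp elim by blast
      then have "rep g x \<in> rep h ` A \<longleftrightarrow> ?k (rep g x) \<in> A"
        using elim rep_image_mem_iff[OF hc _ A] by metis
      moreover have "rep g x \<in> rep g ` A \<longleftrightarrow> x \<in> A"
        using elim by (intro rep_image_mem_iff[OF gc _ A]) auto
      ultimately show ?case using elim by auto
    qed
  qed
  then have "AE x in M. rep g x = rep h x"
    using AE_rep[OF gc rep_inv_right[OF hc]] AE_space
  proof eventually_elim
    case (elim x)
    have "?k (rep g x) \<in> space M"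
      using measurable_space[OF rep_measurable[OF ii]] sp elim by blast
    then have "x = ?k (rep g x)"
      using standard_borel_separates[OF borel \<E>(2,3)] elim by blast
    then show ?case using elim by simp
  qed
  then show ?thesis by (rule rep_eqI[OF gc hc])
qed

text \<open>Both topologies make every \<open>img_dist A\<close> continuous, so the images of
  \<open>A\<close> under \<open>s n\<close> approach those under \<open>x\<close> and under
  \<open>z\<close>, for every measurable \<open>A\<close>. This supplies the uniqueness hypothesis
  of \<open>closed_graph_polish\<close>.\<close>

lemma limits_agree:
  assumes \<tau>: "group_topology GG \<tau>" "completely_metrizable_space \<tau>"
    and \<sigma>: "group_topology GG \<sigma>" "completely_metrizable_space \<sigma>"
    and s: "\<And>n. s n \<in> G"
    and x: "limitin \<tau> s x sequentially" and z: "limitin \<sigma> s z sequentially"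
  shows "x = z"
proof -
  have "topspace \<tau> = G" "topspace \<sigma> = G" using \<tau>(1) \<sigma>(1) by (auto simp: group_topology_def)
  then have G: "x \<in> G" "z \<in> G" using x z limitin_topspace by metis+
  have ev: "eventually (\<lambda>n. img_dist A y (s n) < e) sequentially"
    if \<rho>: "group_topology GG \<rho>" "completely_metrizable_space \<rho>" "limitin \<rho> s y sequentially" "y \<in> G"
      "A \<in> sets M" "0 < e" for \<rho> y A e
  proof -
    obtain W where W: "openin \<rho> W" "y \<in> W" "\<forall>h\<in>W. img_dist A y h < e"
      using img_dist_continuous[OF \<rho>(1,2,5,4,6)] by blast
    then have "eventually (\<lambda>n. s n \<in> W) sequentially"
      using \<rho>(3) by (auto simp: limitin_def)
    then show ?thesis using W(3) by (auto elim: eventually_mono)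
  qed
  show ?thesis
  proof (rule img_dist_separates[OF G])
    fix A assume A: "A \<in> sets M"
    have "img_dist A x z \<le> e" if e: "0 < e" for e
    proof -
      have e2: "0 < e / 2" using e by simp
      have "eventually (\<lambda>n. img_dist A x (s n) < e / 2 \<and> img_dist A z (s n) < e / 2) sequentially"
        using ev[OF \<tau> x G(1) A e2] ev[OF \<sigma> z G(2) A e2] by (rule eventually_conj)
      then obtain n where n: "img_dist A x (s n) < e / 2" "img_dist A z (s n) < e / 2"
        by (auto simp: eventually_sequentially)
      have "img_dist A x z \<le> img_dist A x (s n) + img_dist A (s n) z"
        using A G s by (intro img_dist_triangle) auto
      then show ?thesis using n by (simp add: img_dist_sym[of A z])
    qed
    then have "img_dist A x z \<le> 0" by (rule field_le_epsilon) simp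
    then show "img_dist A x z = 0" by (simp add: img_dist_def measure_le_0_iff)
  qed
qed

text \<open>Stated for a completely metrizable \<tau> so that the uniform topology can be inserted;
  for two Polish topologies it applies in both directions.\<close>

lemma polish_coarser:
  assumes \<tau>: "group_topology GG \<tau>" "completely_metrizable_space \<tau>"
    and \<sigma>: "polish_group_topology GG \<sigma>" and U: "openin \<sigma> U"
  shows "openin \<tau> U"
proof (rule closed_graph_polish[OF group_GG \<tau> \<sigma> _ U])
  have \<sigma>': "group_topology GG \<sigma>" "completely_metrizable_space \<sigma>"
    using \<sigma> by (auto simp: polish_group_topology_def polish_topology_def)
  fix s x z assume "\<And>n. s n \<in> carrier GG" "limitin \<tau> s x sequentially" "limitin \<sigma> s z sequentially"
  then show "x = z" using limits_agree[OF \<tau> \<sigma>', of s x z] by simp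
qed

section \<open>The uniform metric as a complete metric for a group topology\<close>

lemma neq_rep_sets: "g \<in> carrier (Aut M) \<Longrightarrow> h \<in> carrier (Aut M) \<Longrightarrow>
    {x \<in> space M. rep g x \<noteq> rep h x} \<in> sets M"
  using neq_sets[OF borel] rep_measurable by blast

sublocale U: Metric_space "carrier (Aut M)" "uniform_dist M"
  by (rule Metric_space_uniform_dist[OF prob_space_axioms borel])

sublocale UG: Metric_space G "uniform_dist M"
  by (rule U.subspace) auto

lemma uniform_topology_G: "subtopology (uniform_topology M) G = UG.mtopology"
proof -
  interpret Submetric "carrier (Aut M)" "uniform_dist M" G
    by unfold_locales auto
  show ?thesis using mtopology_submetric by (simp add: uniform_topology_def)
qed

text \<open>The products can differ at \<open>x\<close> only if \<open>h\<close> and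
  \<open>h'\<close> differ at \<open>x\<close> or \<open>g\<close> and \<open>g'\<close> differ at
  \<open>h x\<close>; as \<open>h\<close> preserves the measure, the latter set has measure
  \<open>uniform_dist M g g'\<close>.\<close>

lemma uniform_dist_mult:
  assumes c: "g \<in> carrier (Aut M)" "h \<in> carrier (Aut M)" "g' \<in> carrier (Aut M)" "h' \<in> carrier (Aut M)"
  shows "uniform_dist M (g \<otimes>\<^bsub>Aut M\<^esub> h) (g' \<otimes>\<^bsub>Aut M\<^esub> h') \<le> uniform_dist M g g' + uniform_dist M h h'"
proof -
  note sg = neq_rep_sets[OF c(1,3)] and sh = neq_rep_sets[OF c(2,4)]
  let ?A = "{x \<in> space M. rep g (rep h x) \<noteq> rep g' (rep h x)}"
  have A: "?A \<in> sets M"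
    using neq_sets[OF borel measurable_comp[OF rep_measurable[OF c(2)] rep_measurable[OF c(1)]]
        measurable_comp[OF rep_measurable[OF c(2)] rep_measurable[OF c(3)]]] by (simp add: o_def)
  have "uniform_dist M (g \<otimes>\<^bsub>Aut M\<^esub> h) (g' \<otimes>\<^bsub>Aut M\<^esub> h') \<le>
      measure M (?A \<union> {x \<in> space M. rep h x \<noteq> rep h' x})"
    unfolding uniform_dist_def
  proof (rule finite_measure_mono_AE)
    show "AE x in M. x \<in> {x \<in> space M. rep (g \<otimes>\<^bsub>Aut M\<^esub> h) x \<noteq> rep (g' \<otimes>\<^bsub>Aut M\<^esub> h') x} \<longrightarrow>
        x \<in> ?A \<union> {x \<in> space M. rep h x \<noteq> rep h' x}"
      using rep_mult[OF c(1,2)] rep_mult[OF c(3,4)] by eventually_elim auto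
  qed (use A sh in auto)
  also have "\<dots> \<le> measure M ?A + uniform_dist M h h'"
    unfolding uniform_dist_def by (rule measure_Un_le[OF A sh])
  also have "measure M ?A = uniform_dist M g g'"
    unfolding uniform_dist_def using measure_rep_vimage[OF c(2) sg] by simp
  finally show ?thesis by simp
qed

text \<open>The inverses are \<open>g\<inverse> h h\<inverse>\<close> and
  \<open>g\<inverse> g h\<inverse>\<close>, two products differing only in the middle
  factor.\<close>

lemma uniform_dist_inv:
  assumes c: "g \<in> carrier (Aut M)" "h \<in> carrier (Aut M)"
  shows "uniform_dist M (inv\<^bsub>Aut M\<^esub> g) (inv\<^bsub>Aut M\<^esub> h) \<le> uniform_dist M g h"
proof -
  let ?i = "inv\<^bsub>Aut M\<^esub> g" and ?j = "inv\<^bsub>Aut M\<^esub> h"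
  have "uniform_dist M (?i \<otimes>\<^bsub>Aut M\<^esub> h \<otimes>\<^bsub>Aut M\<^esub> ?j) (?i \<otimes>\<^bsub>Aut M\<^esub> g \<otimes>\<^bsub>Aut M\<^esub> ?j) \<le>
      uniform_dist M (?i \<otimes>\<^bsub>Aut M\<^esub> h) (?i \<otimes>\<^bsub>Aut M\<^esub> g) + uniform_dist M ?j ?j"
    using c by (intro uniform_dist_mult) auto
  also have "\<dots> \<le> uniform_dist M ?i ?i + uniform_dist M h g + uniform_dist M ?j ?j"
    using c by (intro add_right_mono uniform_dist_mult) auto
  finally show ?thesis using c by (simp add: Aut.m_assoc U.commute)
qed

lemma group_topology_uniform: "group_topology GG UG.mtopology"
  unfolding group_topology_def
proof (intro conjI)
  show "topspace UG.mtopology = carrier GG" by simp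
  have "continuous_map (prod_topology UG.mtopology UG.mtopology) UG.mtopology (\<lambda>(x, y). x \<otimes>\<^bsub>Aut M\<^esub> y)"
    unfolding UG.continuous_map_to_metric
  proof (intro ballI allI impI)
    fix p :: "('a \<Rightarrow> 'a) set \<times> ('a \<Rightarrow> 'a) set" and e :: real
    assume p: "p \<in> topspace (prod_topology UG.mtopology UG.mtopology)" and e: "0 < e"
    obtain g h where gh: "p = (g, h)" "g \<in> G" "h \<in> G" using p by auto
    let ?W = "UG.mball g (e / 2) \<times> UG.mball h (e / 2)"
    have "(\<lambda>(x, y). x \<otimes>\<^bsub>Aut M\<^esub> y) q \<in> UG.mball ((\<lambda>(x, y). x \<otimes>\<^bsub>Aut M\<^esub> y) p) e" if "q \<in> ?W" for q
      using that gh uniform_dist_mult[of g h "fst q" "snd q"] by (auto simp: G_carrier G_closed)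
    then show "\<exists>W. openin (prod_topology UG.mtopology UG.mtopology) W \<and> p \<in> W \<and>
        (\<forall>q\<in>W. (\<lambda>(x, y). x \<otimes>\<^bsub>Aut M\<^esub> y) q \<in> UG.mball ((\<lambda>(x, y). x \<otimes>\<^bsub>Aut M\<^esub> y) p) e)"
      using gh e by (intro exI[of _ ?W]) (auto simp: openin_prod_Times_iff)
  qed
  then show "continuous_map (prod_topology UG.mtopology UG.mtopology) UG.mtopology (\<lambda>(x, y). x \<otimes>\<^bsub>GG\<^esub> y)"
    by simp
  show "continuous_map UG.mtopology UG.mtopology (\<lambda>x. inv\<^bsub>GG\<^esub> x)"
    unfolding UG.continuous_map_to_metric
  proof (intro ballI allI impI)
    fix g and e :: real assume g: "g \<in> topspace UG.mtopology" and e: "0 < e"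
    have "inv\<^bsub>GG\<^esub> h \<in> UG.mball (inv\<^bsub>GG\<^esub> g) e" if "h \<in> UG.mball g e" for h
      using that uniform_dist_inv[of g h] Aut.m_inv_consistent[OF subgroup_G]
      by (auto simp: G_carrier G_closed)
    then show "\<exists>W. openin UG.mtopology W \<and> g \<in> W \<and> (\<forall>h\<in>W. inv\<^bsub>GG\<^esub> h \<in> UG.mball (inv\<^bsub>GG\<^esub> g) e)"
      using g e by (intro exI[of _ "UG.mball g e"]) auto
  qed
qed

text \<open>By Borel-Cantelli, \<open>rep (t n) x\<close> is eventually constant for almost every
  \<open>x\<close>; \<open>T x\<close> is the final value. The index \<open>K\<close> is recorded
  because \<open>T\<close> agrees with \<open>t n\<close> where \<open>K\<close> equals
  \<open>n\<close>, the form needed for pasting.\<close>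

lemma uniform_geometric_limit:
  assumes t: "\<And>n. t n \<in> G" and fast: "\<And>n. uniform_dist M (t n) (t (Suc n)) < 1 / 2 ^ n"
  shows "\<exists>T K. T \<in> measurable M M \<and> K \<in> measurable M (count_space (UNIV :: nat set)) \<and>
    (\<forall>x. T x = rep (t (K x)) x) \<and> (AE x in M. \<exists>k. \<forall>n\<ge>k. rep (t n) x = T x)"
proof -
  define N where "N n = {x \<in> space M. rep (t n) x \<noteq> rep (t (Suc n)) x}" for n
  have N: "N n \<in> sets M" for n unfolding N_def using neq_rep_sets t by blast
  have "summable (\<lambda>n. measure M (N n))"
  proof (rule summable_comparison_test')
    show "summable (\<lambda>n. (1 / 2 :: real) ^ n)" by (rule summable_geometric) simp
    show "norm (measure M (N n)) \<le> (1 / 2) ^ n" if "0 \<le> n" for n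
      using fast[of n] by (simp add: N_def uniform_dist_def power_divide)
  qed
  then have ev: "AE x in M. eventually (\<lambda>n. x \<in> space M - N n) sequentially"
    using N by (intro borel_cantelli_AE1) (auto simp: emeasure_eq_measure)
  define Q where "Q k x \<longleftrightarrow> (\<forall>n. n \<ge> k \<longrightarrow> x \<notin> N n)" for k x
  \<comment> \<open>Where no index works, \<open>LEAST\<close> has an unspecified value; this
    concerns only a null set, and \<open>K\<close> remains measurable.\<close>
  define K where "K x = (LEAST k. Q k x)" for x
  have [measurable]: "N n \<in> sets M" for n by (rule N)
  have Km: "K \<in> measurable M (count_space UNIV)"
    unfolding K_def Q_def by measurable
  define T where "T x = rep (t (K x)) x" for x
  have "T \<in> measurable M M"
    unfolding T_def by (rule measurable_compose_countable[OF G_rep_measurable[OF t] Km])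
  moreover have "\<forall>x. T x = rep (t (K x)) x" by (simp add: T_def)
  moreover have "AE x in M. \<exists>k. \<forall>n\<ge>k. rep (t n) x = T x"
    using ev AE_space
  proof eventually_elim
    case (elim x)
    then obtain k where "Q k x" by (auto simp: eventually_sequentially Q_def)
    then have Q: "Q (K x) x" unfolding K_def by (rule LeastI)
    have "rep (t n) x = rep (t (K x)) x" if "n \<ge> K x" for n
      using that
    proof (induction n rule: dec_induct)
      case (step n)
      then have "x \<notin> N n" using Q by (simp add: Q_def)
      then show ?case using step elim(2) by (simp add: N_def)
    qed simp
    then show ?case unfolding T_def by (intro exI[of _ "K x"]) blast
  qed
  ultimately show ?thesis using Km by (intro exI[of _ T] exI[of _ K] conjI)
qed

text \<open>\<open>T x\<close> is one of the countably many points \<open>t j x\<close>, so almost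
  everywhere the inverses also stabilise at \<open>T x\<close>. For large \<open>n\<close> both
  limits are attained and \<open>S (T x)\<close> is \<open>t n\<close> inverse applied to
  \<open>t n x\<close>.\<close>

lemma limit_inverse:
  assumes t: "\<And>n :: nat. t n \<in> G"
    and T: "\<And>x. T x = rep (t (K x)) x" "AE x in M. \<exists>k. \<forall>n\<ge>k. rep (t n) x = T x"
    and S: "AE x in M. \<exists>k. \<forall>n\<ge>k. rep (inv\<^bsub>Aut M\<^esub> t n) x = S x"
  shows "AE x in M. S (T x) = x"
proof -
  have tc: "t n \<in> carrier (Aut M)" for n using t by auto
  have "AE x in M. \<forall>j. \<exists>k. \<forall>n\<ge>k. rep (inv\<^bsub>Aut M\<^esub> t n) (rep (t j) x) = S (rep (t j) x)"
    unfolding AE_all_countable using AE_rep[OF tc S] by blast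
  moreover have "AE x in M. \<forall>n. rep (inv\<^bsub>Aut M\<^esub> t n) (rep (t n) x) = x"
    unfolding AE_all_countable using rep_inv_left[OF tc] by blast
  ultimately show ?thesis using T(2)
  proof eventually_elim
    case (elim x)
    obtain k where k: "\<forall>n\<ge>k. rep (inv\<^bsub>Aut M\<^esub> t n) (T x) = S (T x)"
      using elim(1) unfolding T(1) by blast
    obtain l where l: "\<forall>n\<ge>l. rep (t n) x = T x" using elim(3) by blast
    have "S (T x) = rep (inv\<^bsub>Aut M\<^esub> t (max k l)) (T x)" using k by simp
    also have "\<dots> = rep (inv\<^bsub>Aut M\<^esub> t (max k l)) (rep (t (max k l)) x)" using l by simp
    also have "\<dots> = x" using elim(2) by blast
    finally show ?case .
  qed
qed

text \<open>Along a rapidly Cauchy subsequence the elements and their inverses stabilise almost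
  everywhere. The limits are mutually inverse, preserve the measure, and are corrected on a null set
  to an automorphism, which lies in \<open>G\<close> by pasting.\<close>

lemma uniform_mcomplete: "UG.mcomplete"
  unfolding UG.mcomplete_def
proof (intro allI impI)
  fix s assume s: "UG.MCauchy s"
  obtain r where r: "strict_mono (r :: nat \<Rightarrow> nat)"
    "\<And>n. uniform_dist M (s (r n)) (s (r (Suc n))) < 1 / 2 ^ n"
    using UG.MCauchy_geometric_subsequence[OF s] by blast
  define t where "t = s \<circ> r"
  have t: "t n \<in> G" for n using s by (auto simp: t_def UG.MCauchy_def)
  have tc: "t n \<in> carrier (Aut M)" for n using t by auto
  have fast: "uniform_dist M (t n) (t (Suc n)) < 1 / 2 ^ n" for n using r(2) by (simp add: t_def)
  have it: "inv\<^bsub>Aut M\<^esub> t n \<in> G" for n using t by auto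
  have ifast: "uniform_dist M (inv\<^bsub>Aut M\<^esub> t n) (inv\<^bsub>Aut M\<^esub> t (Suc n)) < 1 / 2 ^ n" for n
    using uniform_dist_inv[OF tc tc] fast by (rule le_less_trans)
  obtain T K where T: "T \<in> measurable M M" "K \<in> measurable M (count_space UNIV)"
    "\<And>x. T x = rep (t (K x)) x" "AE x in M. \<exists>k. \<forall>n\<ge>k. rep (t n) x = T x"
    using uniform_geometric_limit[OF t fast] by blast
  obtain S L where S: "S \<in> measurable M M"
    "\<And>x. S x = rep (inv\<^bsub>Aut M\<^esub> t (L x)) x" "AE x in M. \<exists>k. \<forall>n\<ge>k. rep (inv\<^bsub>Aut M\<^esub> t n) x = S x"
    using uniform_geometric_limit[OF it ifast] by blast
  have ST: "AE x in M. S (T x) = x" by (rule limit_inverse[OF t T(3,4) S(3)])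
  \<comment> \<open>The same argument for the sequence of inverses, whose own inverses are the
    \<open>t n\<close>.\<close>
  have TS: "AE x in M. T (S x) = x"
    by (rule limit_inverse[OF it S(2,3)]) (use T(4) tc in simp)
  \<comment> \<open>The points where some term from index \<open>n\<close> on differs from
    \<open>T\<close>. These sets decrease to a null set, which gives both the invariance of the
    measure and the convergence to the limit.\<close>
  define D where "D n = (\<Union>m\<in>{n..}. {x \<in> space M. rep (t m) x \<noteq> T x})" for n
  have D: "D n \<in> sets M" for n
    unfolding D_def using neq_sets[OF borel rep_measurable[OF tc] T(1)]
    by (intro sets.countable_UN') auto
  have "decseq D" by (force simp: D_def decseq_def)
  then have "(\<lambda>n. measure M (D n)) \<longlonglongrightarrow> measure M (\<Inter>n. D n)"
    using D by (intro finite_Lim_measure_decseq) auto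
  moreover have "measure M (\<Inter>n. D n) = measure M {}"
  proof (rule finite_measure_eq_AE)
    show "AE x in M. x \<in> (\<Inter>n. D n) \<longleftrightarrow> x \<in> {}"
      using T(4)
    proof eventually_elim
      case (elim x)
      then obtain k where "\<forall>n\<ge>k. rep (t n) x = T x" by blast
      then have "x \<notin> D k" by (auto simp: D_def)
      then show ?case by blast
    qed
  qed (use D in auto)
  ultimately have D0: "(\<lambda>n. measure M (D n)) \<longlonglongrightarrow> 0" by simp
  \<comment> \<open>Applied to complements as well, this one inequality yields equality.\<close>
  have le: "measure M (T -` B \<inter> space M) \<le> measure M B" if B: "B \<in> sets M" for B
  proof (rule LIMSEQ_le_const[of "\<lambda>n. measure M B + measure M (D n)"])
    show "(\<lambda>n. measure M B + measure M (D n)) \<longlonglongrightarrow> measure M B"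
      using tendsto_add[OF tendsto_const D0, of "measure M B"] by simp
    have "measure M (T -` B \<inter> space M) \<le> measure M B + measure M (D n)" for n
    proof -
      have m: "rep (t n) -` B \<inter> space M \<in> sets M" "measure M (rep (t n) -` B \<inter> space M) = measure M B"
        using measurable_sets[OF rep_measurable[OF tc] B] measure_distr[OF rep_measurable[OF tc] B, of n]
          mp_bijD(4)[OF rep_in(1)[OF tc]] by auto
      have "measure M (T -` B \<inter> space M) \<le> measure M ((rep (t n) -` B \<inter> space M) \<union> D n)"
        using m D by (intro finite_measure_mono) (auto simp: D_def)
      also have "\<dots> \<le> measure M (rep (t n) -` B \<inter> space M) + measure M (D n)"
        using m D by (intro measure_Un_le) auto
      finally show ?thesis using m by simp
    qed
    then show "\<exists>N. \<forall>n\<ge>N. measure M (T -` B \<inter> space M) \<le> measure M B + measure M (D n)" by blast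
  qed
  have "distr M M T = M"
  proof (rule measure_eqI)
    fix B assume "B \<in> sets (distr M M T)"
    then have B: "B \<in> sets M" by simp
    note TB = measurable_sets[OF T(1) B]
    have "T -` (space M - B) \<inter> space M = space M - (T -` B \<inter> space M)"
      using measurable_space[OF T(1)] by auto
    then have "measure M (space M - (T -` B \<inter> space M)) \<le> measure M (space M - B)"
      using le[of "space M - B"] B by simp
    then have "measure M B \<le> measure M (T -` B \<inter> space M)"
      using prob_compl[OF TB] prob_compl[OF B] by simp
    then show "emeasure (distr M M T) B = emeasure M B"
      using le[OF B] T(1) B by (simp add: emeasure_distr emeasure_eq_measure)
  qed simp
  then obtain R where R: "R \<in> mp_bij M" "AE x in M. R x = T x"
    using ae_invertible_mp_bij[OF T(1) S(1) _ ST TS] by blast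
  define g where "g = aut_class M R"
  have gc: "g \<in> carrier (Aut M)" using R(1) by (simp add: g_def Aut_def)
  have gT: "AE x in M. rep g x = T x"
    using rep_aut_class[OF R(1)] R(2) by (auto simp: g_def)
  \<comment> \<open>The pieces are the level sets of \<open>K\<close>, on which \<open>T\<close>
    agrees with \<open>t n\<close>.\<close>
  have gG: "g \<in> G"
  proof (rule glue[of t "\<lambda>n. K -` {n} \<inter> space M"])
    show "K -` {n} \<inter> space M \<in> sets M" for n using measurable_sets[OF T(2)] by simp
    show "disjoint_family (\<lambda>n. K -` {n} \<inter> space M)" by (auto simp: disjoint_family_on_def)
    show "AE x in M. x \<in> K -` {n} \<inter> space M \<longrightarrow> rep g x = rep (t n) x" for n
      using gT by eventually_elim (simp add: T(3))
  qed (use t gc in auto)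
  have le_D: "uniform_dist M (t n) g \<le> measure M (D n)" for n
    unfolding uniform_dist_def
  proof (rule finite_measure_mono_AE)
    show "AE x in M. x \<in> {x \<in> space M. rep (t n) x \<noteq> rep g x} \<longrightarrow> x \<in> D n"
      using gT by eventually_elim (auto simp: D_def)
  qed (rule D)
  have "(\<lambda>n. uniform_dist M (t n) g) \<longlonglongrightarrow> 0"
    by (rule tendsto_sandwich[OF _ _ tendsto_const D0]) (simp_all add: le_D)
  then have "limitin UG.mtopology t g sequentially"
    using t gG by (simp add: UG.limit_metric_sequentially UG.limitin_metric_dist_null)
  then have "limitin UG.mtopology s g sequentially"
    unfolding t_def using UG.MCauchy_convergent_subsequence[OF s r(1)] by blast
  then show "\<exists>x. limitin UG.mtopology s x sequentially" by blast
qed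

lemma completely_metrizable_uniform: "completely_metrizable_space UG.mtopology"
  using UG.completely_metrizable_space_mtopology uniform_mcomplete by blast

end

theorem theorem4p7:
  fixes M :: "'a measure" and G :: "('a \<Rightarrow> 'a) set set"
  assumes "standard_prob_space M"
    and "full_group M G"
    and "ergodic_group M G"
  shows "(\<forall>\<tau>. polish_group_topology ((Aut M)\<lparr>carrier := G\<rparr>) \<tau> \<longrightarrow>
            (\<forall>U. openin \<tau> U \<longrightarrow> openin (subtopology (uniform_topology M) G) U)) \<and>
         (\<forall>\<tau>. polish_group_topology ((Aut M)\<lparr>carrier := G\<rparr>) \<tau> \<longrightarrow>
            (\<forall>U. openin (subtopology (weak_topology M) G) U \<longrightarrow> openin \<tau> U)) \<and>
         (\<forall>\<tau> \<tau>'. polish_group_topology ((Aut M)\<lparr>carrier := G\<rparr>) \<tau> \<longrightarrow>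
            polish_group_topology ((Aut M)\<lparr>carrier := G\<rparr>) \<tau>' \<longrightarrow> \<tau> = \<tau>')"
proof -
  interpret ergodic_full_group M G using assms by unfold_locales
  have P: "group_topology GG \<tau>" "completely_metrizable_space \<tau>"
    if "polish_group_topology GG \<tau>" for \<tau>
    using that by (auto simp: polish_group_topology_def polish_topology_def)
  show ?thesis
  proof (intro conjI allI impI)
    fix \<tau> U assume "polish_group_topology GG \<tau>" "openin \<tau> U"
    then show "openin (subtopology (uniform_topology M) G) U"
      unfolding uniform_topology_G
      by (rule polish_coarser[OF group_topology_uniform completely_metrizable_uniform])
  next
    fix \<tau> U assume "polish_group_topology GG \<tau>" "openin (subtopology (weak_topology M) G) U"
    then show "openin \<tau> U" using weak_topology_coarser P by blast
  next
    fix \<tau> \<tau>' assume "polish_group_topology GG \<tau>" "polish_group_topology GG \<tau>'"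
    then show "\<tau> = \<tau>'" unfolding topology_eq using polish_coarser P by blast
  qed
qed

end
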